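(* Let $G$ be a topological subgroup of $S_\infty$. Then for every $x, y \in G$ with $x \neq y$, there exists a continuous, irreducible, unitary representation $\pi$ of $G$ such that $\pi(x) \neq \pi(y)$.
   Context: $S_\infty$ is the group of all permutations of a countably infinite set $\mathbf{X}$, equipped with the topology of pointwise convergence, where $\mathbf{X}$ is discrete (a basis at the identity is given by pointwise stabilizers of finite subsets). A topological subgroup (not assumed closed) carries the subspace topology. A continuous unitary representation of a topological group $G$ is a homomorphism $\pi\colon G \to U(\mathcal{H})$ to the unitary group of a complex Hilbert space $\mathcal{H}$ such that $g \mapsto \pi(g)\xi$ is continuous for every $\xi \in \mathcal{H}$. It is irreducible if $\mathcal{H}\ne 0$ and $\mathcal{H}$ has no non-trivial closed invariant subspaces. *)

theory Defs
  imports "HOL-Analysis.Analysis" "HOL-Algebra.Bij" "HOL-Algebra.Module"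
begin

definition complex_field :: "complex ring"
  where "complex_field = \<lparr>carrier = UNIV, monoid.mult = (*), monoid.one = 1, ring.zero = 0, ring.add = (+)\<rparr>"

text \<open>
  Complex inner product spaces carry an explicit carrier set, so that one can quantify
  existentially over them and speak of their subspaces. The vector space structure is that of a
  HOL-Algebra module over the field of complex numbers; the ring multiplication and unit which
  the module record inherits are never used. The inner product is linear in the first argument.

  Since the carrier and the operations are arbitrary, structures over the type
  \<^typ>\<open>nat \<Rightarrow> complex\<close> cover all separable Hilbert spaces up to isomorphism. A continuous
  irreducible representation of a subgroup of the permutation group of a countable set is cyclic
  and the subgroup is separable, so it always acts on such a space.
\<close>

record 'v cinner_space = "(complex, 'v) module" +
  cinner :: "'v \<Rightarrow> 'v \<Rightarrow> complex"

definition cnorm :: "'v cinner_space \<Rightarrow> 'v \<Rightarrow> real"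
  where "cnorm H v = sqrt (Re (cinner H v v))"

definition cdist :: "'v cinner_space \<Rightarrow> 'v \<Rightarrow> 'v \<Rightarrow> real"
  where "cdist H v w = cnorm H (v \<ominus>\<^bsub>H\<^esub> w)"

definition norm_topology :: "'v cinner_space \<Rightarrow> 'v topology"
  where "norm_topology H = Metric_space.mtopology (carrier H) (cdist H)"

locale complex_hilbert_space = Module.module complex_field H
  for H :: "'v cinner_space" (structure) +
  assumes cinner_add_left:
      "\<lbrakk>u \<in> carrier H; v \<in> carrier H; w \<in> carrier H\<rbrakk>
        \<Longrightarrow> cinner H (u \<oplus>\<^bsub>H\<^esub> v) w = cinner H u w + cinner H v w"
    and cinner_smult_left:
      "\<lbrakk>v \<in> carrier H; w \<in> carrier H\<rbrakk> \<Longrightarrow> cinner H (a \<odot>\<^bsub>H\<^esub> v) w = a * cinner H v w"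
    and cinner_commute:
      "\<lbrakk>v \<in> carrier H; w \<in> carrier H\<rbrakk> \<Longrightarrow> cinner H w v = cnj (cinner H v w)"
    and cinner_nonneg:
      "v \<in> carrier H \<Longrightarrow> 0 \<le> Re (cinner H v v)"
    and cinner_definite:
      "\<lbrakk>v \<in> carrier H; cinner H v v = 0\<rbrakk> \<Longrightarrow> v = \<zero>\<^bsub>H\<^esub>"
    and complete: "Metric_space.mcomplete (carrier H) (cdist H)"

definition unitary :: "'v cinner_space \<Rightarrow> ('v \<Rightarrow> 'v) set"
  where "unitary H = {T \<in> Bij (carrier H).
    (\<forall>v\<in>carrier H. \<forall>w\<in>carrier H. T (v \<oplus>\<^bsub>H\<^esub> w) = T v \<oplus>\<^bsub>H\<^esub> T w) \<and>
    (\<forall>a. \<forall>v\<in>carrier H. T (a \<odot>\<^bsub>H\<^esub> v) = a \<odot>\<^bsub>H\<^esub> T v) \<and>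
    (\<forall>v\<in>carrier H. \<forall>w\<in>carrier H. cinner H (T v) (T w) = cinner H v w)}"

definition unitary_group :: "'v cinner_space \<Rightarrow> ('v \<Rightarrow> 'v) monoid"
  where "unitary_group H = BijGroup (carrier H)\<lparr>carrier := unitary H\<rparr>"

definition continuous_unitary_rep ::
  "'g monoid \<Rightarrow> 'g topology \<Rightarrow> 'v cinner_space \<Rightarrow> ('g \<Rightarrow> 'v \<Rightarrow> 'v) \<Rightarrow> bool"
  where "continuous_unitary_rep \<Gamma> \<T> H \<pi> \<longleftrightarrow>
    complex_hilbert_space H \<and>
    \<pi> \<in> hom \<Gamma> (unitary_group H) \<and>
    (\<forall>\<xi>\<in>carrier H. continuous_map \<T> (norm_topology H) (\<lambda>g. \<pi> g \<xi>))"

definition irreducible_rep ::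
  "'g monoid \<Rightarrow> 'v cinner_space \<Rightarrow> ('g \<Rightarrow> 'v \<Rightarrow> 'v) \<Rightarrow> bool"
  where "irreducible_rep \<Gamma> H \<pi> \<longleftrightarrow>
    carrier H \<noteq> {\<zero>\<^bsub>H\<^esub>} \<and>
    (\<forall>W. submodule W complex_field H \<and> closedin (norm_topology H) W \<and>
         (\<forall>g\<in>carrier \<Gamma>. \<forall>w\<in>W. \<pi> g w \<in> W)
       \<longrightarrow> W = {\<zero>\<^bsub>H\<^esub>} \<or> W = carrier H)"

text \<open>
  The elements of \<^term>\<open>BijGroup X\<close> are the permutations of \<^term>\<open>X\<close>, extended by
  \<^term>\<open>undefined\<close> outside \<^term>\<open>X\<close>, hence points of the product of copies of \<^term>\<open>X\<close>
  indexed by \<^term>\<open>X\<close>; pointwise convergence is the product topology.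
\<close>

definition pointwise_topology :: "'a set \<Rightarrow> ('a \<Rightarrow> 'a) topology"
  where "pointwise_topology X =
    subtopology (product_topology (\<lambda>_. discrete_topology X) X) (carrier (BijGroup X))"

end

theory Submission
  imports Defs
begin

text \<open>
  Two distinct elements \<open>x\<close>, \<open>y\<close> of the group differ at some point \<open>p\<close>. Let \<open>T\<close> be the orbit of
  \<open>p\<close>. The quasi-regular representation on the square-summable functions on \<open>T\<close> is continuous and
  tells \<open>x\<close> from \<open>y\<close>, but it has no reason to be irreducible. An irreducible
  representation comes from an extreme point argument in the style of Gelfand and Raikov. The group
  is in general not locally compact, but the argument works because every positive definite function
  equal to \<open>1\<close> on the open stabilizer of \<open>p\<close> is automatically continuous: these functions form a
  compact convex set for pointwise convergence, with no continuity condition that could be lost in the limit.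

  Such a function is the same thing as a group-invariant positive semidefinite kernel on \<open>T\<close> with
  diagonal \<open>1\<close>. Coded on a countable index set and extended by zero outside \<open>T\<close>, these kernels form
  the set \<open>normalized_kernels\<close>, which is compact (\<open>compact_normalized_kernels\<close>) and contains the
  identity kernel, whose value at \<open>(x p, y p)\<close> is \<open>0\<close>. By countability there is a continuous
  strictly convex functional on it. Subtract from it a large multiple of the real part of the value
  at \<open>(x p, y p)\<close>: the result is maximal at an extreme kernel \<open>K\<close> with \<open>K (x p, y p) \<noteq> 1\<close>
  (\<open>exists_extreme_kernel\<close>).

  A positive semidefinite kernel has a reproducing kernel Hilbert space. It consists of complex
  functions on the index set, so that the group acts simply by translating functions. The
  representation is continuous because a vector is approximated by combinations of finitely many
  kernel functions \<open>K (i, _)\<close>, and fixing finitely many points is an open condition. It separates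
  \<open>x\<close> and \<open>y\<close>, because they send the kernel function at \<open>p\<close> to those at \<open>x p\<close> and \<open>y p\<close>, which
  differ as \<open>K (x p, y p) \<noteq> 1 = K (y p, y p)\<close>. Finally it is irreducible
  (\<open>translation_irreducible\<close>): projecting the kernel functions onto a closed invariant subspace
  and onto its complement writes \<open>K\<close> as a sum of two invariant positive semidefinite kernels; by
  extremality (\<open>extreme_kernel_summand\<close>) the first is a multiple \<open>t K\<close>, so the projection acts on
  every kernel function as the scalar \<open>t\<close>, and the subspace is zero or everything according to
  whether \<open>t\<close> vanishes or not.
\<close>

section \<open>Inner product spaces and orthogonal projection\<close>

text \<open>
  The discriminant argument behind the Cauchy-Schwarz inequality. With \<open>A = 0\<close> it says that a
  minimal distance is attained orthogonally, and this is how it enters the projection theorem.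
\<close>

lemma quadratic_nonneg_imp_bound:
  fixes A C :: real and B :: complex
  assumes "\<And>t. 0 \<le> A + 2 * Re (t * B) + (cmod t)\<^sup>2 * C"
  shows "(cmod B)\<^sup>2 \<le> A * C"
proof -
  \<comment> \<open>The choice \<open>t = - r cnj B\<close> makes the linear term a real multiple of \<open>|B|\<^sup>2\<close>.\<close>
  have r: "0 \<le> A - 2 * r * (cmod B)\<^sup>2 + r\<^sup>2 * (cmod B)\<^sup>2 * C" for r
  proof -
    have "cnj B * B = of_real ((cmod B)\<^sup>2)"
      using complex_norm_square[of B] by (simp add: mult.commute)
    then have "Re (- of_real r * cnj B * B) = - r * (cmod B)\<^sup>2"
      by (simp only: mult.assoc) (simp del: of_real_power)
    then show ?thesis
      using assms[of "- of_real r * cnj B"] by (simp add: norm_mult power_mult_distrib)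
  qed
  show ?thesis
  proof (cases "B = 0")
    case True
    have "0 \<le> A" using assms[of 0] by simp
    moreover have "0 \<le> C"
    proof (rule ccontr)
      assume "\<not> 0 \<le> C"
      then have C: "C < 0" by simp
      define s where "s = sqrt ((A + 1) / - C)"
      have "s\<^sup>2 = (A + 1) / - C" unfolding s_def using \<open>0 \<le> A\<close> C by (intro real_sqrt_pow2 divide_nonneg_pos) auto
      then have "s\<^sup>2 * C = - (A + 1)" using C by (simp add: field_simps)
      then show False using assms[of "of_real s"] True by simp
    qed
    ultimately show ?thesis using True by simp
  next
    case False
    then have pos: "(cmod B)\<^sup>2 > 0" by simp
    show ?thesis
    proof (cases "C > 0")
      case True
      have "0 \<le> A - 2 * (1 / C) * (cmod B)\<^sup>2 + (1 / C)\<^sup>2 * (cmod B)\<^sup>2 * C" by (rule r)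
      then have "0 \<le> A - (cmod B)\<^sup>2 / C" using True by (simp add: field_simps power2_eq_square)
      then show ?thesis using True by (simp add: field_simps)
    next
      case False
      define s where "s = (\<bar>A\<bar> + 1) / (cmod B)\<^sup>2"
      have "s * (cmod B)\<^sup>2 = \<bar>A\<bar> + 1" using pos by (simp add: s_def)
      moreover have "s\<^sup>2 * (cmod B)\<^sup>2 * C \<le> 0" using False by (intro mult_nonneg_nonpos) auto
      ultimately show ?thesis using r[of s] by linarith
    qed
  qed
qed

text \<open>
  Completeness is left out, since triangle inequality and projections are needed before the
  completeness of a concrete space is known. The last two assumptions also concern arguments outside
  the carrier: \<^locale>\<open>Metric_space\<close> demands a distance that is nonnegative and symmetric on the
  whole type.
\<close>

locale inner_product_space = Module.module complex_field H
  for H :: "'v cinner_space" (structure) +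
  assumes cinner_add_left:
      "\<lbrakk>u \<in> carrier H; v \<in> carrier H; w \<in> carrier H\<rbrakk>
        \<Longrightarrow> cinner H (u \<oplus>\<^bsub>H\<^esub> v) w = cinner H u w + cinner H v w"
    and cinner_smult_left:
      "\<lbrakk>v \<in> carrier H; w \<in> carrier H\<rbrakk> \<Longrightarrow> cinner H (a \<odot>\<^bsub>H\<^esub> v) w = a * cinner H v w"
    and cinner_commute:
      "\<lbrakk>v \<in> carrier H; w \<in> carrier H\<rbrakk> \<Longrightarrow> cinner H w v = cnj (cinner H v w)"
    and cinner_nonneg:
      "v \<in> carrier H \<Longrightarrow> 0 \<le> Re (cinner H v v)"
    and cinner_definite:
      "\<lbrakk>v \<in> carrier H; cinner H v v = 0\<rbrakk> \<Longrightarrow> v = \<zero>\<^bsub>H\<^esub>"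
    and cdist_nonneg: "0 \<le> cdist H v w"
    and cdist_commute: "cdist H v w = cdist H w v"

context inner_product_space
begin

lemma smult_carrier [simp, intro]: "v \<in> carrier H \<Longrightarrow> a \<odot> v \<in> carrier H"
  using smult_closed[of a v] by (simp add: complex_field_def)

lemma cinner_add_right:
  assumes "u \<in> carrier H" "v \<in> carrier H" "w \<in> carrier H"
  shows "cinner H w (u \<oplus> v) = cinner H w u + cinner H w v"
  using assms cinner_commute[of "u \<oplus> v" w] cinner_commute[of u w] cinner_commute[of v w]
  by (simp add: cinner_add_left)

lemma cinner_smult_right:
  assumes "v \<in> carrier H" "w \<in> carrier H"
  shows "cinner H w (a \<odot> v) = cnj a * cinner H w v"
  using assms cinner_commute[of "a \<odot> v" w] cinner_commute[of v w]
  by (simp add: cinner_smult_left)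

lemma cinner_zero_left [simp]:
  assumes "w \<in> carrier H" shows "cinner H \<zero> w = 0"
  using cinner_add_left[of \<zero> \<zero> w] assms by simp

lemma cinner_zero_right [simp]:
  assumes "w \<in> carrier H" shows "cinner H w \<zero> = 0"
  using cinner_add_right[of \<zero> \<zero> w] assms by simp

lemma cinner_diff_left:
  assumes "u \<in> carrier H" "v \<in> carrier H" "w \<in> carrier H"
  shows "cinner H (u \<ominus> v) w = cinner H u w - cinner H v w"
proof -
  have "cinner H v w + cinner H (\<ominus> v) w = cinner H (v \<oplus> \<ominus> v) w"
    using assms by (simp add: cinner_add_left)
  also have "\<dots> = 0" using assms by (simp add: M.r_neg)
  finally show ?thesis using assms by (simp add: M.minus_eq cinner_add_left add_eq_0_iff2)
qed

lemma cinner_diff_right: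
  assumes "u \<in> carrier H" "v \<in> carrier H" "w \<in> carrier H"
  shows "cinner H w (u \<ominus> v) = cinner H w u - cinner H w v"
  using assms cinner_commute[of "u \<ominus> v" w] cinner_commute[of u w] cinner_commute[of v w]
  by (simp add: cinner_diff_left)

lemmas cinner_expand = cinner_add_left cinner_add_right cinner_diff_left cinner_diff_right
  cinner_smult_left cinner_smult_right

lemma cnorm_power2: "v \<in> carrier H \<Longrightarrow> (cnorm H v)\<^sup>2 = Re (cinner H v v)"
  by (simp add: cnorm_def cinner_nonneg)

lemma cnorm_nonneg [simp]: "v \<in> carrier H \<Longrightarrow> 0 \<le> cnorm H v"
  by (simp add: cnorm_def cinner_nonneg)

lemma cinner_self: "v \<in> carrier H \<Longrightarrow> cinner H v v = of_real ((cnorm H v)\<^sup>2)"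
  using cinner_commute[of v v] by (simp add: cnorm_power2 complex_eq_iff)

lemma cnorm_eq_0_iff: "v \<in> carrier H \<Longrightarrow> cnorm H v = 0 \<longleftrightarrow> v = \<zero>"
  using cinner_self[of v] cinner_definite[of v] by (auto simp: cnorm_def)

lemma Re_cinner_commute: 
  "v \<in> carrier H \<Longrightarrow> w \<in> carrier H \<Longrightarrow> Re (cinner H w v) = Re (cinner H v w)"
  using cinner_commute[of v w] by simp

lemma cnorm_add_smult_power2:
  assumes v: "v \<in> carrier H" and w: "w \<in> carrier H"
  shows "(cnorm H (v \<oplus> t \<odot> w))\<^sup>2 =
    (cnorm H v)\<^sup>2 + 2 * Re (t * cinner H w v) + (cmod t)\<^sup>2 * (cnorm H w)\<^sup>2"
proof -
  have "Re (cnj t * cinner H v w) = Re (t * cinner H w v)"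
    using cinner_commute[OF v w] by simp
  moreover have "t * (cnj t * cinner H w w) = of_real ((cmod t)\<^sup>2 * (cnorm H w)\<^sup>2)"
    using w by (simp add: cinner_self mult.assoc[symmetric] flip: complex_norm_square)
  then have "Re (t * (cnj t * cinner H w w)) = (cmod t)\<^sup>2 * (cnorm H w)\<^sup>2" 
    by (simp only: Re_complex_of_real)
  ultimately show ?thesis using v w
    by (simp only: cnorm_power2 smult_carrier M.add.m_closed cinner_expand plus_complex.simps)
       (simp add: algebra_simps)
qed

lemma Cauchy_Schwarz:
  assumes v: "v \<in> carrier H" and w: "w \<in> carrier H"
  shows "cmod (cinner H v w) \<le> cnorm H v * cnorm H w"
proof -
  have "(cmod (cinner H v w))\<^sup>2 \<le> (cnorm H w)\<^sup>2 * (cnorm H v)\<^sup>2"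
  proof (rule quadratic_nonneg_imp_bound)
    show "0 \<le> (cnorm H w)\<^sup>2 + 2 * Re (t * cinner H v w) + (cmod t)\<^sup>2 * (cnorm H v)\<^sup>2" for t
      using zero_le_power2[of "cnorm H (w \<oplus> t \<odot> v)"] by (simp only: cnorm_add_smult_power2[OF w v])
  qed
  then have "(cmod (cinner H v w))\<^sup>2 \<le> (cnorm H v * cnorm H w)\<^sup>2"
    by (simp add: power_mult_distrib mult.commute)
  then show ?thesis using v w by (meson abs_le_square_iff abs_of_nonneg mult_nonneg_nonneg norm_ge_zero cnorm_nonneg power2_le_imp_le)
qed

lemma cdist_power2:
  assumes "u \<in> carrier H" "v \<in> carrier H"
  shows "(cdist H u v)\<^sup>2 = (cnorm H u)\<^sup>2 + (cnorm H v)\<^sup>2 - 2 * Re (cinner H u v)"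
  using assms Re_cinner_commute[of u v] by (simp add: cdist_def cnorm_power2 cinner_expand)

lemma cdist_triangle:
  assumes u: "u \<in> carrier H" and v: "v \<in> carrier H" and w: "w \<in> carrier H"
  shows "cdist H u w \<le> cdist H u v + cdist H v w"
proof -
  have "Re (cinner H (u \<ominus> v) (v \<ominus> w)) \<le> cdist H u v * cdist H v w"
    using Cauchy_Schwarz[of "u \<ominus> v" "v \<ominus> w"] complex_Re_le_cmod[of "cinner H (u \<ominus> v) (v \<ominus> w)"] u v w
    by (simp add: cdist_def)
  moreover have "(cdist H u w)\<^sup>2 =
      (cdist H u v)\<^sup>2 + (cdist H v w)\<^sup>2 + 2 * Re (cinner H (u \<ominus> v) (v \<ominus> w))"
    using u v w Re_cinner_commute[of u v] Re_cinner_commute[of v w] Re_cinner_commute[of u w]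
    by (simp add: cdist_power2 cinner_expand cnorm_power2)
  ultimately have "(cdist H u w)\<^sup>2 \<le> (cdist H u v + cdist H v w)\<^sup>2"
    by (simp add: power2_sum)
  then show ?thesis
    by (rule power2_le_imp_le) (use u v w in \<open>simp add: cdist_def\<close>)
qed

sublocale Met: Metric_space "carrier H" "cdist H"
proof
  show "cdist H v w = 0 \<longleftrightarrow> v = w" if v: "v \<in> carrier H" and w: "w \<in> carrier H" for v w
  proof -
    have "v \<ominus> w = \<zero> \<longleftrightarrow> v = w"
      using v w M.minus_equality[of v "\<ominus> w"] by (auto simp: M.minus_eq M.r_neg)
    then show ?thesis using v w by (simp add: cdist_def cnorm_eq_0_iff)
  qed
qed (fact cdist_nonneg cdist_commute cdist_triangle)+

lemma norm_topology_eq: "norm_topology H = Met.mtopology"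
  by (simp add: norm_topology_def)

lemma complex_hilbert_spaceI:
  assumes "Met.mcomplete" shows "complex_hilbert_space H"
proof
  show "Met.mcomplete" by fact
qed (erule (2) cinner_add_left, erule (1) cinner_smult_left, erule (1) cinner_commute,
  erule cinner_nonneg, erule (1) cinner_definite)

text \<open>
  By the parallelogram law a sequence in \<open>W\<close> whose distances to \<open>v\<close> approach the infimum is
  Cauchy. Its limit is a nearest point of \<open>W\<close>, and moving that point inside \<open>W\<close> cannot decrease
  the distance, which forces orthogonality.
\<close>

theorem orthogonal_projection:
  assumes complete: "Met.mcomplete"
    and sub: "submodule W complex_field H"
    and closed: "closedin (norm_topology H) W"
    and v: "v \<in> carrier H"
  shows "\<exists>p\<in>W. \<forall>w\<in>W. cinner H (v \<ominus> p) w = 0"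
proof -
  have WH: "W \<subseteq> carrier H" and "W \<noteq> {}"
    using submoduleE[OF sub] by auto
  have Wsmult: "a \<odot> w \<in> W" if "w \<in> W" for a w
    using submoduleE(4)[OF sub, of a w] that by (simp add: complex_field_def)
  have Wadd: "w \<oplus> w' \<in> W" if "w \<in> W" "w' \<in> W" for w w'
    using submoduleE(5)[OF sub] that by blast
  define \<delta> where "\<delta> = (INF w\<in>W. (cdist H v w)\<^sup>2)"
  have bdd: "bdd_below ((\<lambda>w. (cdist H v w)\<^sup>2) ` W)"
    by (rule bdd_belowI2[of _ 0]) simp
  have \<delta>_le: "\<delta> \<le> (cdist H v w)\<^sup>2" if "w \<in> W" for w
    unfolding \<delta>_def using bdd that by (rule cINF_lower)
  have \<delta>_nonneg: "0 \<le> \<delta>"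
    unfolding \<delta>_def using \<open>W \<noteq> {}\<close> by (intro cINF_greatest) auto
  have "\<exists>w\<in>W. (cdist H v w)\<^sup>2 < \<delta> + 1 / real (Suc n)" for n
  proof -
    have "(INF w\<in>W. (cdist H v w)\<^sup>2) < \<delta> + 1 / real (Suc n)" by (simp flip: \<delta>_def)
    then show ?thesis using cINF_less_iff[OF \<open>W \<noteq> {}\<close> bdd] by blast
  qed
  then obtain w where wW: "w n \<in> W" and w_le: "(cdist H v (w n))\<^sup>2 < \<delta> + 1 / real (Suc n)" for n
    by metis
  have parallelogram: "(cdist H a b)\<^sup>2 = 2 * (cdist H v a)\<^sup>2 + 2 * (cdist H v b)\<^sup>2
      - 4 * (cdist H v ((1/2) \<odot> (a \<oplus> b)))\<^sup>2" if "a \<in> W" "b \<in> W" for a b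
  proof -
    have ab: "a \<in> carrier H" "b \<in> carrier H" using that WH by auto
    let ?m = "(1/2) \<odot> (a \<oplus> b)"
    have mm: "cinner H ?m ?m = (1/4) * cinner H (a \<oplus> b) (a \<oplus> b)"
      and vm: "cinner H v ?m = (1/2) * cinner H v (a \<oplus> b)"
      using ab v by (simp_all add: cinner_smult_left cinner_smult_right)
    have "4 * Re (cinner H ?m ?m) = Re (cinner H a a) + Re (cinner H b b) + 2 * Re (cinner H a b)"
      unfolding mm using ab Re_cinner_commute[of a b] by (simp add: cinner_add_left cinner_add_right)
    moreover have "2 * Re (cinner H v ?m) = Re (cinner H v a) + Re (cinner H v b)"
      unfolding vm using ab v by (simp add: cinner_add_right)
    ultimately show ?thesis
      using ab v by (simp add: cdist_power2 cnorm_power2)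
  qed
  have close: "(cdist H (w m) (w n))\<^sup>2 \<le> 2 / real (Suc m) + 2 / real (Suc n)" for m n
    using parallelogram[OF wW wW, of m n] w_le[of m] w_le[of n]
      \<delta>_le[OF Wsmult[OF Wadd[OF wW wW]], of "1/2" m n] by simp
  have "Met.MCauchy w"
    unfolding Met.MCauchy_def
  proof (intro conjI allI impI)
    show "range w \<subseteq> carrier H" using wW WH by auto
    fix e :: real assume "e > 0"
    then have "e\<^sup>2 / 4 > 0" by simp
    then obtain N where N: "1 / real (Suc N) < e\<^sup>2 / 4"
      by (metis nat_approx_posE)
    have "cdist H (w m) (w n) < e" if "N \<le> m" "N \<le> n" for m n
    proof -
      have "1 / real (Suc m) \<le> 1 / real (Suc N)" "1 / real (Suc n) \<le> 1 / real (Suc N)"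
        using that by (auto simp: frac_le)
      then have "(cdist H (w m) (w n))\<^sup>2 < e\<^sup>2" using close[of m n] N by linarith
      then show ?thesis using \<open>e > 0\<close> by (simp add: power2_less_imp_less)
    qed
    then show "\<exists>N. \<forall>n n'. N \<le> n \<longrightarrow> N \<le> n' \<longrightarrow> cdist H (w n) (w n') < e" by blast
  qed
  then obtain p where p: "limitin Met.mtopology w p sequentially"
    using complete unfolding Met.mcomplete_def by blast
  have pW: "p \<in> W"
    using limitin_closedin[OF p] closed wW by (simp add: norm_topology_eq)
  then have pH: "p \<in> carrier H" using WH by blast
  have "(\<lambda>n. cdist H (w n) p) \<longlonglongrightarrow> 0"
    using p by (simp add: Met.limitin_metric_dist_null)
  moreover have "(\<lambda>n. sqrt (\<delta> + 1 / real (Suc n))) \<longlonglongrightarrow> sqrt (\<delta> + 0)"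
    by (intro tendsto_intros LIMSEQ_Suc[OF lim_1_over_n])
  ultimately have lim: "(\<lambda>n. sqrt (\<delta> + 1 / real (Suc n)) + cdist H (w n) p) \<longlonglongrightarrow> sqrt \<delta> + 0"
    by (intro tendsto_add) simp_all
  have "cdist H v p \<le> sqrt (\<delta> + 1 / real (Suc n)) + cdist H (w n) p" for n
  proof -
    have "cdist H v (w n) \<le> sqrt (\<delta> + 1 / real (Suc n))"
      using w_le[of n] by (intro real_le_rsqrt) simp
    then show ?thesis using Met.triangle[OF v _ pH, of "w n"] wW[of n] WH by force
  qed
  then have "cdist H v p \<le> sqrt \<delta>"
    using LIMSEQ_le_const[OF lim, of "cdist H v p"] by auto
  then have p_min: "(cdist H v p)\<^sup>2 \<le> \<delta>"
    using \<delta>_nonneg power_mono[of "cdist H v p" "sqrt \<delta>" 2] by simp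
  have "cinner H (v \<ominus> p) u = 0" if u: "u \<in> W" for u
  proof -
    have uH: "u \<in> carrier H" using u WH by blast
    have vp: "v \<ominus> p \<in> carrier H" using v pH by simp
    have "0 \<le> 0 + 2 * Re (t * cinner H u (v \<ominus> p)) + (cmod t)\<^sup>2 * (cnorm H u)\<^sup>2" for t
    proof -
      let ?q = "p \<oplus> (-t) \<odot> u"
      have "cinner H (v \<ominus> ?q) (v \<ominus> ?q) = cinner H ((v \<ominus> p) \<oplus> t \<odot> u) ((v \<ominus> p) \<oplus> t \<odot> u)"
        using v pH uH by (simp add: cinner_expand algebra_simps)
      then have "(cdist H v ?q)\<^sup>2 = (cnorm H ((v \<ominus> p) \<oplus> t \<odot> u))\<^sup>2"
        by (simp add: cdist_def cnorm_def)
      also have "\<dots> = (cdist H v p)\<^sup>2 + 2 * Re (t * cinner H u (v \<ominus> p)) + (cmod t)\<^sup>2 * (cnorm H u)\<^sup>2"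
        unfolding cdist_def by (rule cnorm_add_smult_power2[OF vp uH])
      finally show ?thesis
        using p_min \<delta>_le[OF Wadd[OF pW Wsmult[OF u]], of "-t"] by linarith
    qed
    then have "(cmod (cinner H u (v \<ominus> p)))\<^sup>2 \<le> 0 * (cnorm H u)\<^sup>2"
      by (rule quadratic_nonneg_imp_bound)
    then have "cinner H u (v \<ominus> p) = 0" by simp
    then show ?thesis using cinner_commute[OF uH vp] by simp
  qed
  then show ?thesis using pW by blast
qed

end

section \<open>Kernels\<close>

text \<open>
  A list of pairs \<open>(a, i)\<close> stands for the formal combination of basis symbols \<open>e i\<close> with
  coefficients \<open>a\<close>, and \<open>kernel_form K\<close> for the sesquilinear form in which \<open>e i\<close> and \<open>e j\<close> have
  product \<open>K (i, j)\<close>. Lists are a convenient model: addition is concatenation, a map on indices acts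
  by \<^const>\<open>map\<close>, and repeated indices do no harm because the form is only positive semidefinite
  anyway.
\<close>

definition kernel_form ::
    "('i \<times> 'i \<Rightarrow> complex) \<Rightarrow> (complex \<times> 'i) list \<Rightarrow> (complex \<times> 'i) list \<Rightarrow> complex"
  where "kernel_form K xs ys = (\<Sum>(a, i)\<leftarrow>xs. \<Sum>(b, j)\<leftarrow>ys. a * cnj b * K (i, j))"

definition psd_kernel :: "('i \<times> 'i \<Rightarrow> complex) \<Rightarrow> bool"
  where "psd_kernel K \<longleftrightarrow>
    (\<forall>i j. K (j, i) = cnj (K (i, j))) \<and> (\<forall>xs. 0 \<le> Re (kernel_form K xs xs))"

lemma kernel_form_Nil [simp]: "kernel_form K [] ys = 0" "kernel_form K xs [] = 0"
  by (auto simp: kernel_form_def split_def intro: sum_list_0)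

lemma kernel_form_append_left: "kernel_form K (xs @ xs') ys = kernel_form K xs ys + kernel_form K xs' ys"
  by (simp add: kernel_form_def)

lemma kernel_form_append_right: "kernel_form K xs (ys @ ys') = kernel_form K xs ys + kernel_form K xs ys'"
  by (simp add: kernel_form_def split_def sum_list_addf)

definition scale_comb :: "complex \<Rightarrow> (complex \<times> 'i) list \<Rightarrow> (complex \<times> 'i) list"
  where "scale_comb c = map (\<lambda>(a, i). (c * a, i))"

lemma kernel_form_scale_left: "kernel_form K (scale_comb c xs) ys = c * kernel_form K xs ys"
proof -
  have "(\<Sum>(b, j)\<leftarrow>ys. (c * a) * cnj b * K (i, j)) = c * (\<Sum>(b, j)\<leftarrow>ys. a * cnj b * K (i, j))" for a i
    by (induction ys) (auto simp: distrib_left)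
  then show ?thesis
    unfolding kernel_form_def scale_comb_def by (induction xs) (auto simp: distrib_left)
qed

lemma kernel_form_scale_right: "kernel_form K xs (scale_comb c ys) = cnj c * kernel_form K xs ys"
proof -
  have "(\<Sum>(b, j)\<leftarrow>scale_comb c ys. a * cnj b * K (i, j)) = cnj c * (\<Sum>(b, j)\<leftarrow>ys. a * cnj b * K (i, j))" for a i
    unfolding scale_comb_def by (induction ys) (auto simp: distrib_left)
  then show ?thesis
    unfolding kernel_form_def by (induction xs) (auto simp: distrib_left)
qed

lemma kernel_form_Cons_left: "kernel_form K (x # xs) ys = kernel_form K [x] ys + kernel_form K xs ys"
  by (rule kernel_form_append_left[of K "[x]" xs, simplified append_Cons append_Nil])

lemma kernel_form_Cons_right: "kernel_form K xs (y # ys) = kernel_form K xs [y] + kernel_form K xs ys"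
  by (rule kernel_form_append_right[of K xs "[y]" ys, simplified append_Cons append_Nil])

lemma kernel_form_single [simp]: "kernel_form K [(a, i)] [(b, j)] = a * cnj b * K (i, j)"
  by (simp add: kernel_form_def)

lemma kernel_form_map:
  "kernel_form K (map (apsnd f) xs) (map (apsnd f) ys) = kernel_form (\<lambda>(i, j). K (f i, f j)) xs ys"
  by (simp add: kernel_form_def split_def comp_def)

lemma kernel_form_mult_kernel: "kernel_form (\<lambda>x. c * K x) xs ys = c * kernel_form K xs ys"
proof -
  have "(\<Sum>(b, j)\<leftarrow>ys. a * cnj b * (c * K (i, j))) = c * (\<Sum>(b, j)\<leftarrow>ys. a * cnj b * K (i, j))" for a i
    by (induction ys) (auto simp: distrib_left)
  then show ?thesis
    unfolding kernel_form_def by (induction xs) (auto simp: distrib_left)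
qed

lemma kernel_form_commute:
  assumes "\<And>i j. K (j, i) = cnj (K (i, j))"
  shows "kernel_form K ys xs = cnj (kernel_form K xs ys)"
proof -
  have *: "kernel_form K [x] [y] = cnj (kernel_form K [y] [x])" for x y
  proof -
    obtain a i b j where "x = (a, i)" "y = (b, j)" by fastforce
    then show ?thesis using assms[of i j] by simp
  qed
  have **: "kernel_form K [x] xs = cnj (kernel_form K xs [x])" for x
  proof (induction xs)
    case (Cons y ys)
    then show ?case
      by (simp only: kernel_form_Cons_left[of K y ys] kernel_form_Cons_right[of K "[x]" y ys]
          complex_cnj_add *[of x])
  qed simp
  show ?thesis
  proof (induction ys)
    case (Cons y ys)
    then show ?case
      by (simp only: kernel_form_Cons_left[of K y ys] kernel_form_Cons_right[of K xs y ys]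
          complex_cnj_add **)
  qed simp
qed

context inner_product_space
begin

definition lincomb :: "('i \<Rightarrow> 'v) \<Rightarrow> (complex \<times> 'i) list \<Rightarrow> 'v"
  where "lincomb e xs = foldr (\<lambda>(a, i) v. a \<odot> e i \<oplus> v) xs \<zero>"

lemma lincomb_simps [simp]:
  "lincomb e [] = \<zero>" "lincomb e ((a, i) # xs) = a \<odot> e i \<oplus> lincomb e xs"
  by (simp_all add: lincomb_def)

lemma lincomb_carrier [simp]: "range e \<subseteq> carrier H \<Longrightarrow> lincomb e xs \<in> carrier H"
proof (induction xs)
  case (Cons x xs)
  then show ?case by (cases x) (simp add: image_subset_iff)
qed simp

lemma cinner_lincomb:
  assumes "range e \<subseteq> carrier H"
  shows "cinner H (lincomb e xs) (lincomb e ys) = kernel_form (\<lambda>(i, j). cinner H (e i) (e j)) xs ys"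
proof -
  have e: "e i \<in> carrier H" for i using assms by auto
  let ?K = "\<lambda>(i, j). cinner H (e i) (e j)"
  have *: "a * cinner H (e i) (lincomb e ys) = kernel_form ?K [(a, i)] ys" for a i
  proof (induction ys)
    case (Cons y ys)
    obtain b j where y: "y = (b, j)" by fastforce
    show ?case
      using assms Cons.IH
      by (simp add: y e cinner_expand kernel_form_Cons_right[of _ _ "(b, j)" ys] algebra_simps)
  qed (simp add: e)
  show ?thesis
  proof (induction xs)
    case (Cons x xs)
    obtain a i where x: "x = (a, i)" by fastforce
    show ?case
      using assms Cons.IH
      by (simp add: x e * cinner_expand kernel_form_Cons_left[of _ "(a, i)" xs])
  qed (use assms in simp)
qed

text \<open>
  Gram kernels are positive semidefinite, because their form is the squared norm of an actual linear
  combination of vectors.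
\<close>

lemma psd_kernel_cinner:
  assumes "range e \<subseteq> carrier H"
  shows "psd_kernel (\<lambda>(i, j). cinner H (e i) (e j))"
proof -
  have "cinner H (e j) (e i) = cnj (cinner H (e i) (e j))" for i j
    using assms by (intro cinner_commute) auto
  moreover have "0 \<le> Re (kernel_form (\<lambda>(i, j). cinner H (e i) (e j)) xs xs)" for xs
    using cinner_nonneg[of "lincomb e xs"] assms by (simp add: cinner_lincomb)
  ultimately show ?thesis unfolding psd_kernel_def prod.case by blast
qed

end

section \<open>The Hilbert space with a given reproducing kernel\<close>

definition comb_seminorm :: "('i \<times> 'i \<Rightarrow> complex) \<Rightarrow> (complex \<times> 'i) list \<Rightarrow> real"
  where "comb_seminorm K xs = sqrt (Re (kernel_form K xs xs))"

definition comb_diff :: "(complex \<times> 'i) list \<Rightarrow> (complex \<times> 'i) list \<Rightarrow> (complex \<times> 'i) list"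
  where "comb_diff xs ys = xs @ scale_comb (-1) ys"

text \<open>
  The function on indices that a formal combination induces through its products with the basis
  symbols; on a single symbol \<open>e i\<close> it is the kernel function \<open>K (i, _)\<close>.
\<close>

definition comb_fun :: "('i \<times> 'i \<Rightarrow> complex) \<Rightarrow> (complex \<times> 'i) list \<Rightarrow> 'i \<Rightarrow> complex"
  where "comb_fun K xs j = kernel_form K xs [(1, j)]"

definition comb_Cauchy :: "('i \<times> 'i \<Rightarrow> complex) \<Rightarrow> (nat \<Rightarrow> (complex \<times> 'i) list) \<Rightarrow> bool"
  where "comb_Cauchy K X \<longleftrightarrow>
    (\<forall>e>0. \<exists>N. \<forall>m\<ge>N. \<forall>n\<ge>N. comb_seminorm K (comb_diff (X m) (X n)) < e)"

text \<open>
  The Hilbert space is the completion of the formal combinations, but its elements are to be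
  functions on the indices rather than classes of Cauchy sequences. A Cauchy sequence is therefore
  identified with the pointwise limit of the functions that it induces.
\<close>

definition represents ::
    "('i \<times> 'i \<Rightarrow> complex) \<Rightarrow> (nat \<Rightarrow> (complex \<times> 'i) list) \<Rightarrow> ('i \<Rightarrow> complex) \<Rightarrow> bool"
  where "represents K X f \<longleftrightarrow>
    comb_Cauchy K X \<and> (\<forall>j. (\<lambda>n. comb_fun K (X n) j) \<longlonglongrightarrow> f j)"

definition rkhs_carrier :: "('i \<times> 'i \<Rightarrow> complex) \<Rightarrow> ('i \<Rightarrow> complex) set"
  where "rkhs_carrier K = {f. \<exists>X. represents K X f}"

definition rkhs_inner :: "('i \<times> 'i \<Rightarrow> complex) \<Rightarrow> ('i \<Rightarrow> complex) \<Rightarrow> ('i \<Rightarrow> complex) \<Rightarrow> complex"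
  where "rkhs_inner K f g =
    lim (\<lambda>n. kernel_form K ((SOME X. represents K X f) n) ((SOME Y. represents K Y g) n))"

text \<open>
  The addition below clips its arguments to the carrier. As a result the additive inverse is a
  definite function even outside the carrier and \<open>cdist\<close> is symmetric and nonnegative on the whole
  type, as \<^locale>\<open>Metric_space\<close> demands.
\<close>

definition rkhs_clip :: "('i \<times> 'i \<Rightarrow> complex) \<Rightarrow> ('i \<Rightarrow> complex) \<Rightarrow> 'i \<Rightarrow> complex"
  where "rkhs_clip K f = (if f \<in> rkhs_carrier K then f else (\<lambda>_. 0))"

definition rkhs :: "('i \<times> 'i \<Rightarrow> complex) \<Rightarrow> ('i \<Rightarrow> complex) cinner_space"
  where "rkhs K = \<lparr>carrier = rkhs_carrier K, monoid.mult = (\<lambda>f g. f), monoid.one = (\<lambda>_. 0),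
    ring.zero = (\<lambda>_. 0), ring.add = (\<lambda>f g j. rkhs_clip K f j + rkhs_clip K g j),
    smult = (\<lambda>c f j. c * f j), cinner = rkhs_inner K\<rparr>"

lemma rkhs_simps [simp]:
  "carrier (rkhs K) = rkhs_carrier K"
  "\<zero>\<^bsub>rkhs K\<^esub> = (\<lambda>_. 0)"
  "c \<odot>\<^bsub>rkhs K\<^esub> f = (\<lambda>j. c * f j)"
  "cinner (rkhs K) = rkhs_inner K"
  by (simp_all add: rkhs_def)

lemma rkhs_add: "f \<oplus>\<^bsub>rkhs K\<^esub> g = (\<lambda>j. rkhs_clip K f j + rkhs_clip K g j)"
  by (simp add: rkhs_def)

lemmas kernel_form_sesquilinear = kernel_form_append_left kernel_form_append_right
  kernel_form_scale_left kernel_form_scale_right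

lemma kernel_form_diff_left:
  "kernel_form K (comb_diff xs xs') ys = kernel_form K xs ys - kernel_form K xs' ys"
  by (simp add: comb_diff_def kernel_form_sesquilinear)

lemma kernel_form_diff_right:
  "kernel_form K xs (comb_diff ys ys') = kernel_form K xs ys - kernel_form K xs ys'"
  by (simp add: comb_diff_def kernel_form_sesquilinear)

lemmas kernel_form_expand = kernel_form_sesquilinear kernel_form_diff_left kernel_form_diff_right

locale positive_kernel =
  fixes K :: "'i \<times> 'i \<Rightarrow> complex"
  assumes psd: "psd_kernel K"
begin

abbreviation "s \<equiv> kernel_form K"
abbreviation "q \<equiv> comb_seminorm K"

lemma form_commute: "s ys xs = cnj (s xs ys)"
  using psd unfolding psd_kernel_def by (intro kernel_form_commute) blast

lemma Re_form_commute: "Re (s ys xs) = Re (s xs ys)"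
  using form_commute[of ys xs] by simp

lemma form_nonneg: "0 \<le> Re (s xs xs)"
  using psd unfolding psd_kernel_def by blast

lemma q_nonneg [simp]: "0 \<le> q xs"
  by (simp add: comb_seminorm_def form_nonneg)

lemma q_power2: "(q xs)\<^sup>2 = Re (s xs xs)"
  by (simp add: comb_seminorm_def form_nonneg)

lemma form_self: "s xs xs = of_real ((q xs)\<^sup>2)"
  using form_commute[of xs xs] by (simp add: q_power2 complex_eq_iff)

text \<open>
  The expansion of a square norm, from which the Cauchy-Schwarz inequality follows by the
  discriminant argument.
\<close>

lemma q_append_scale_power2:
  "(q (xs @ scale_comb t ys))\<^sup>2 = (q xs)\<^sup>2 + 2 * Re (t * s ys xs) + (cmod t)\<^sup>2 * (q ys)\<^sup>2"
proof -
  have 1: "Re (cnj t * s xs ys) = Re (t * s ys xs)"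
    using form_commute[of ys xs] by simp
  have "t * (cnj t * s ys ys) = of_real ((cmod t)\<^sup>2 * (q ys)\<^sup>2)"
    by (simp add: form_self mult.assoc[symmetric] flip: complex_norm_square)
  then have 2: "Re (t * (cnj t * s ys ys)) = (cmod t)\<^sup>2 * (q ys)\<^sup>2"
    by (simp only: Re_complex_of_real)
  have "s (xs @ scale_comb t ys) (xs @ scale_comb t ys) =
      s xs xs + cnj t * s xs ys + t * s ys xs + t * (cnj t * s ys ys)"
    by (simp add: kernel_form_sesquilinear algebra_simps)
  then show ?thesis
    by (simp only: q_power2[of "xs @ scale_comb t ys"] plus_complex.simps 1 2 q_power2[of xs])
qed

lemma form_Cauchy_Schwarz: "cmod (s xs ys) \<le> q xs * q ys"
proof -
  have "(cmod (s xs ys))\<^sup>2 \<le> (q ys)\<^sup>2 * (q xs)\<^sup>2"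
  proof (rule quadratic_nonneg_imp_bound)
    show "0 \<le> (q ys)\<^sup>2 + 2 * Re (t * s xs ys) + (cmod t)\<^sup>2 * (q xs)\<^sup>2" for t
      using zero_le_power2[of "q (ys @ scale_comb t xs)"] by (simp only: q_append_scale_power2)
  qed
  then have "(cmod (s xs ys))\<^sup>2 \<le> (q xs * q ys)\<^sup>2"
    by (simp add: power_mult_distrib mult.commute)
  then show ?thesis by (rule power2_le_imp_le) simp
qed

lemma q_append: "q (xs @ ys) \<le> q xs + q ys"
proof (rule power2_le_imp_le)
  have "(q (xs @ ys))\<^sup>2 = (q xs)\<^sup>2 + (q ys)\<^sup>2 + 2 * Re (s xs ys)"
    using Re_form_commute[of xs ys] by (simp add: q_power2 kernel_form_sesquilinear)
  moreover have "Re (s xs ys) \<le> q xs * q ys"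
    using form_Cauchy_Schwarz[of xs ys] complex_Re_le_cmod[of "s xs ys"] by linarith
  ultimately show "(q (xs @ ys))\<^sup>2 \<le> (q xs + q ys)\<^sup>2" by (simp add: power2_sum)
qed simp

lemma q_cong: "s xs xs = s ys ys \<Longrightarrow> q xs = q ys"
  by (simp add: comb_seminorm_def)

lemma q_le_diff: "q xs \<le> q (comb_diff xs ys) + q ys"
proof -
  have "q xs = q (comb_diff xs ys @ ys)"
    by (rule q_cong) (simp add: kernel_form_expand algebra_simps)
  then show ?thesis using q_append by simp
qed

lemma q_diff_append:
  "q (comb_diff (xs @ ys) (xs' @ ys')) \<le> q (comb_diff xs xs') + q (comb_diff ys ys')"
proof -
  have "q (comb_diff (xs @ ys) (xs' @ ys')) = q (comb_diff xs xs' @ comb_diff ys ys')"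
    by (rule q_cong) (simp add: kernel_form_expand algebra_simps)
  then show ?thesis using q_append by simp
qed

lemma q_scale: "q (scale_comb c xs) = cmod c * q xs"
proof -
  have "(q (scale_comb c xs))\<^sup>2 = (cmod c * q xs)\<^sup>2"
    using q_append_scale_power2[of "[]" c xs] by (simp add: comb_seminorm_def power_mult_distrib)
  then show ?thesis by (simp add: power2_eq_iff_nonneg)
qed

lemma q_diff_scale: "q (comb_diff (scale_comb c xs) (scale_comb c ys)) = cmod c * q (comb_diff xs ys)"
proof -
  have "q (comb_diff (scale_comb c xs) (scale_comb c ys)) = q (scale_comb c (comb_diff xs ys))"
    by (rule q_cong) (simp add: kernel_form_expand algebra_simps)
  then show ?thesis by (simp add: q_scale)
qed

lemma comb_Cauchy_append:
  assumes "comb_Cauchy K X" "comb_Cauchy K Y"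
  shows "comb_Cauchy K (\<lambda>n. X n @ Y n)"
  unfolding comb_Cauchy_def
proof (intro allI impI)
  fix e :: real assume "e > 0"
  then have "e / 2 > 0" by simp
  then obtain M N where
      M: "\<And>m n. m \<ge> M \<Longrightarrow> n \<ge> M \<Longrightarrow> q (comb_diff (X m) (X n)) < e / 2" and
      N: "\<And>m n. m \<ge> N \<Longrightarrow> n \<ge> N \<Longrightarrow> q (comb_diff (Y m) (Y n)) < e / 2"
    using assms unfolding comb_Cauchy_def by metis
  have "q (comb_diff (X m @ Y m) (X n @ Y n)) < e" if "m \<ge> max M N" "n \<ge> max M N" for m n
    using M[of m n] N[of m n] that q_diff_append[of "X m" "Y m" "X n" "Y n"] by simp
  then show "\<exists>N. \<forall>m\<ge>N. \<forall>n\<ge>N. q (comb_diff (X m @ Y m) (X n @ Y n)) < e" by blast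
qed

lemma comb_Cauchy_scale:
  assumes "comb_Cauchy K X"
  shows "comb_Cauchy K (\<lambda>n. scale_comb c (X n))"
  unfolding comb_Cauchy_def
proof (intro allI impI)
  fix e :: real assume "e > 0"
  then have "e / (cmod c + 1) > 0" by (simp add: add_nonneg_pos)
  then obtain N where
      N: "\<And>m n. m \<ge> N \<Longrightarrow> n \<ge> N \<Longrightarrow> q (comb_diff (X m) (X n)) < e / (cmod c + 1)"
    using assms unfolding comb_Cauchy_def by metis
  have "q (comb_diff (scale_comb c (X m)) (scale_comb c (X n))) < e" if "m \<ge> N" "n \<ge> N" for m n
  proof -
    have "cmod c * q (comb_diff (X m) (X n)) \<le> (cmod c + 1) * q (comb_diff (X m) (X n))"
      by (intro mult_right_mono) simp_all
    also have "\<dots> < e" using N[OF that] by (simp add: pos_less_divide_eq add_nonneg_pos mult.commute)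
    finally show ?thesis by (simp add: q_diff_scale)
  qed
  then show "\<exists>N. \<forall>m\<ge>N. \<forall>n\<ge>N. q (comb_diff (scale_comb c (X m)) (scale_comb c (X n))) < e" by blast
qed

lemma comb_Cauchy_const: "comb_Cauchy K (\<lambda>_. xs)"
proof -
  have "q (comb_diff xs xs) = q []" by (rule q_cong) (simp add: kernel_form_expand)
  then show ?thesis by (simp add: comb_Cauchy_def comb_seminorm_def)
qed

lemma comb_Cauchy_bounded:
  assumes "comb_Cauchy K X"
  obtains B where "B > 0" "eventually (\<lambda>n. q (X n) \<le> B) sequentially"
proof -
  obtain N where N: "\<And>m n. m \<ge> N \<Longrightarrow> n \<ge> N \<Longrightarrow> q (comb_diff (X m) (X n)) < 1"
    using assms unfolding comb_Cauchy_def by (meson zero_less_one)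
  have "q (X n) \<le> 1 + q (X N)" if "n \<ge> N" for n
    using N[OF that, of N] q_le_diff[of "X n" "X N"] by simp
  then show ?thesis
    by (intro that[of "1 + q (X N)"]) (auto simp: eventually_sequentially add_pos_nonneg)
qed

lemma form_tendsto_0:
  assumes "(\<lambda>n. q (U n)) \<longlonglongrightarrow> 0" "comb_Cauchy K Y"
  shows "(\<lambda>n. s (U n) (Y n)) \<longlonglongrightarrow> 0" "(\<lambda>n. s (Y n) (U n)) \<longlonglongrightarrow> 0"
proof -
  obtain B where B: "B > 0" "eventually (\<lambda>n. q (Y n) \<le> B) sequentially"
    using comb_Cauchy_bounded[OF assms(2)] .
  have lim: "(\<lambda>n. q (U n) * B) \<longlonglongrightarrow> 0"
    using tendsto_mult_right_zero[OF assms(1)] by (simp add: tendsto_mult_left_zero assms(1))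
  show *: "(\<lambda>n. s (U n) (Y n)) \<longlonglongrightarrow> 0"
  proof (rule Lim_null_comparison[OF _ lim])
    show "eventually (\<lambda>n. cmod (s (U n) (Y n)) \<le> q (U n) * B) sequentially"
      using B(2)
    proof eventually_elim
      case (elim n)
      then show ?case using form_Cauchy_Schwarz[of "U n" "Y n"]
        by (meson mult_left_mono order_trans q_nonneg)
    qed
  qed
  then have "(\<lambda>n. cnj (s (U n) (Y n))) \<longlonglongrightarrow> cnj 0" by (rule tendsto_cnj)
  then show "(\<lambda>n. s (Y n) (U n)) \<longlonglongrightarrow> 0" by (simp add: form_commute[of "Y _"])
qed

lemma form_tendsto_pointwise:
  assumes "\<And>j. (\<lambda>n. comb_fun K (U n) j) \<longlonglongrightarrow> 0"
  shows "(\<lambda>n. s (U n) ys) \<longlonglongrightarrow> 0"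
proof (induction ys)
  case (Cons y ys)
  obtain b j where y: "y = (b, j)" by fastforce
  have "s (U n) [y] = cnj b * comb_fun K (U n) j" for n
    using kernel_form_scale_right[of K "U n" b "[(1, j)]"] by (simp add: y comb_fun_def scale_comb_def)
  then have "(\<lambda>n. s (U n) [y]) \<longlonglongrightarrow> cnj b * 0"
    using tendsto_mult[OF tendsto_const assms] by presburger
  then show ?case
    using tendsto_add[OF _ Cons.IH] by (simp add: kernel_form_Cons_right[of K _ y ys])
qed simp

text \<open>
  Why pointwise limits lose no information: the norm square of \<open>U n\<close> is its product with itself,
  which by the Cauchy property is almost its product with a fixed \<open>U N\<close>, and the latter tends to
  \<open>0\<close> as it only involves finitely many values of the induced function.
\<close>

lemma Cauchy_pointwise_null_imp_null:
  assumes cau: "comb_Cauchy K U" and lim: "\<And>j. (\<lambda>n. comb_fun K (U n) j) \<longlonglongrightarrow> 0"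
  shows "(\<lambda>n. q (U n)) \<longlonglongrightarrow> 0"
proof -
  obtain B where B: "B > 0" "eventually (\<lambda>n. q (U n) \<le> B) sequentially"
    using comb_Cauchy_bounded[OF cau] .
  have "(\<lambda>n. (q (U n))\<^sup>2) \<longlonglongrightarrow> 0"
  proof (rule LIMSEQ_I, goal_cases)
    case (1 e)
    then have "e / (2 * B) > 0" using B by simp
    \<comment> \<open>The bound \<open>B\<close> on the norms turns this into an error below \<open>e / 2\<close> in the product.\<close>
    then obtain N where
        N: "\<And>m n. m \<ge> N \<Longrightarrow> n \<ge> N \<Longrightarrow> q (comb_diff (U m) (U n)) < e / (2 * B)"
      using cau unfolding comb_Cauchy_def by meson
    have "eventually (\<lambda>n. cmod (s (U n) (U N)) < e / 2) sequentially"
      using tendstoD[OF form_tendsto_pointwise[OF lim, where ys = "U N"], of "e / 2"] 1 by simp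
    with B(2) eventually_ge_at_top[of N]
    have "eventually (\<lambda>n. norm ((q (U n))\<^sup>2 - 0) < e) sequentially"
    proof eventually_elim
      case (elim n)
      have "q (U n) * q (comb_diff (U n) (U N)) \<le> B * q (comb_diff (U n) (U N))"
        using elim by (intro mult_right_mono) auto
      also have "\<dots> < e / 2"
        using N[of n N] elim B(1) by (simp add: field_simps)
      finally have "cmod (s (U n) (comb_diff (U n) (U N))) < e / 2"
        using form_Cauchy_Schwarz[of "U n" "comb_diff (U n) (U N)"] by simp
      moreover have "(q (U n))\<^sup>2 = Re (s (U n) (comb_diff (U n) (U N))) + Re (s (U n) (U N))"
        by (simp add: q_power2 kernel_form_expand)
      ultimately have "(q (U n))\<^sup>2 < e"
        using elim complex_Re_le_cmod[of "s (U n) (U N)"]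
          complex_Re_le_cmod[of "s (U n) (comb_diff (U n) (U N))"] by linarith
      then show ?case by simp
    qed
    then show ?case by (simp add: eventually_sequentially)
  qed
  then have "(\<lambda>n. sqrt ((q (U n))\<^sup>2)) \<longlonglongrightarrow> sqrt 0" by (rule tendsto_real_sqrt)
  then show ?thesis by simp
qed

lemma comb_fun_expands:
  "comb_fun K (xs @ ys) j = comb_fun K xs j + comb_fun K ys j"
  "comb_fun K (scale_comb c xs) j = c * comb_fun K xs j"
  "comb_fun K (comb_diff xs ys) j = comb_fun K xs j - comb_fun K ys j"
  by (simp_all add: comb_fun_def kernel_form_expand)

lemma represents_add:
  "represents K X f \<Longrightarrow> represents K Y g \<Longrightarrow> represents K (\<lambda>n. X n @ Y n) (\<lambda>j. f j + g j)"
  by (auto simp: represents_def comb_fun_expands comb_Cauchy_append intro!: tendsto_add)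

lemma represents_scale:
  "represents K X f \<Longrightarrow> represents K (\<lambda>n. scale_comb c (X n)) (\<lambda>j. c * f j)"
  by (auto simp: represents_def comb_fun_expands comb_Cauchy_scale intro!: tendsto_mult)

lemma represents_diff:
  "represents K X f \<Longrightarrow> represents K Y g \<Longrightarrow> represents K (\<lambda>n. comb_diff (X n) (Y n)) (\<lambda>j. f j - g j)"
  using represents_add[of X f "\<lambda>n. scale_comb (-1) (Y n)" "\<lambda>j. -1 * g j"] represents_scale[of Y g "-1"]
  by (simp add: comb_diff_def)

lemma represents_const: "represents K (\<lambda>_. xs) (comb_fun K xs)"
  by (simp add: represents_def comb_Cauchy_const)

lemma represents_unique_null:
  assumes "represents K X f" "represents K X' f"
  shows "(\<lambda>n. q (comb_diff (X n) (X' n))) \<longlonglongrightarrow> 0"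
  using represents_diff[OF assms] by (intro Cauchy_pointwise_null_imp_null) (auto simp: represents_def)

lemma form_Cauchy_convergent:
  assumes "comb_Cauchy K X" "comb_Cauchy K Y"
  shows "convergent (\<lambda>n. s (X n) (Y n))"
proof -
  obtain A where A: "A > 0" "eventually (\<lambda>n. q (X n) \<le> A) sequentially"
    using comb_Cauchy_bounded[OF assms(1)] .
  obtain B where B: "B > 0" "eventually (\<lambda>n. q (Y n) \<le> B) sequentially"
    using comb_Cauchy_bounded[OF assms(2)] .
  obtain M where M: "\<And>n. n \<ge> M \<Longrightarrow> q (X n) \<le> A \<and> q (Y n) \<le> B"
    using eventually_conj[OF A(2) B(2)] by (auto simp: eventually_sequentially)
  have "Cauchy (\<lambda>n. s (X n) (Y n))"
  proof (rule metric_CauchyI)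
    fix e :: real assume "e > 0"
    then have "e / (2 * A) > 0" "e / (2 * B) > 0" using A B by simp_all
    then obtain N1 N2 where
        N1: "\<And>m n. m \<ge> N1 \<Longrightarrow> n \<ge> N1 \<Longrightarrow> q (comb_diff (X m) (X n)) < e / (2 * B)" and
        N2: "\<And>m n. m \<ge> N2 \<Longrightarrow> n \<ge> N2 \<Longrightarrow> q (comb_diff (Y m) (Y n)) < e / (2 * A)"
      using assms unfolding comb_Cauchy_def by metis
    have "dist (s (X m) (Y m)) (s (X n) (Y n)) < e"
      if mn: "m \<ge> max M (max N1 N2)" "n \<ge> max M (max N1 N2)" for m n
    proof -
      have "cmod (s (comb_diff (X m) (X n)) (Y m)) \<le> q (comb_diff (X m) (X n)) * B"
        using form_Cauchy_Schwarz[of "comb_diff (X m) (X n)" "Y m"] M[of m] mn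
        by (meson max.bounded_iff mult_left_mono order_trans q_nonneg)
      also have "\<dots> < e / 2" using N1[of m n] mn B(1) by (simp add: field_simps)
      finally have 1: "cmod (s (comb_diff (X m) (X n)) (Y m)) < e / 2" .
      have "cmod (s (X n) (comb_diff (Y m) (Y n))) \<le> A * q (comb_diff (Y m) (Y n))"
        using form_Cauchy_Schwarz[of "X n" "comb_diff (Y m) (Y n)"] M[of n] mn
        by (meson max.bounded_iff mult_right_mono order_trans q_nonneg)
      also have "\<dots> < e / 2" using N2[of m n] mn A(1) by (simp add: field_simps)
      finally have 2: "cmod (s (X n) (comb_diff (Y m) (Y n))) < e / 2" .
      have "s (X m) (Y m) - s (X n) (Y n) = s (comb_diff (X m) (X n)) (Y m) + s (X n) (comb_diff (Y m) (Y n))"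
        by (simp add: kernel_form_expand)
      then show ?thesis
        using 1 2 norm_triangle_ineq[of "s (comb_diff (X m) (X n)) (Y m)" "s (X n) (comb_diff (Y m) (Y n))"]
        by (simp add: dist_norm)
    qed
    then show "\<exists>M. \<forall>m\<ge>M. \<forall>n\<ge>M. dist (s (X m) (Y m)) (s (X n) (Y n)) < e" by blast
  qed
  then show ?thesis by (simp add: Cauchy_convergent_iff)
qed

text \<open>
  The inner product does not depend on the chosen Cauchy sequences: two sequences representing the
  same function differ by a null sequence. All algebraic laws of the inner product follow from this
  by passing to the limit.
\<close>

lemma rkhs_inner_tendsto:
  assumes f: "represents K X f" and g: "represents K Y g"
  shows "(\<lambda>n. s (X n) (Y n)) \<longlonglongrightarrow> rkhs_inner K f g"
proof -
  define X' where "X' = (SOME X. represents K X f)"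
  define Y' where "Y' = (SOME Y. represents K Y g)"
  have f': "represents K X' f" unfolding X'_def using f by (rule someI[of "\<lambda>X. represents K X f"])
  have g': "represents K Y' g" unfolding Y'_def using g by (rule someI[of "\<lambda>Y. represents K Y g"])
  have cau: "comb_Cauchy K Y" "comb_Cauchy K X'" "comb_Cauchy K Y'"
    using f' g g' by (auto simp: represents_def)
  have "(\<lambda>n. s (X' n) (Y' n)) \<longlonglongrightarrow> rkhs_inner K f g"
    using form_Cauchy_convergent[OF cau(2,3)] unfolding rkhs_inner_def X'_def Y'_def
    by (simp add: convergent_LIMSEQ_iff)
  moreover have "(\<lambda>n. s (comb_diff (X n) (X' n)) (Y n)) \<longlonglongrightarrow> 0"
    by (rule form_tendsto_0(1)[OF represents_unique_null[OF f f'] cau(1)])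
  moreover have "(\<lambda>n. s (X' n) (comb_diff (Y n) (Y' n))) \<longlonglongrightarrow> 0"
    by (rule form_tendsto_0(2)[OF represents_unique_null[OF g g'] cau(2)])
  ultimately have "(\<lambda>n. s (X' n) (Y' n) + s (comb_diff (X n) (X' n)) (Y n)
      + s (X' n) (comb_diff (Y n) (Y' n))) \<longlonglongrightarrow> rkhs_inner K f g + 0 + 0"
    by (intro tendsto_add)
  then show ?thesis by (simp add: kernel_form_expand)
qed

lemma rkhs_carrierI: "represents K X f \<Longrightarrow> f \<in> rkhs_carrier K"
  by (auto simp: rkhs_carrier_def)

lemma rkhs_carrierE:
  assumes "f \<in> rkhs_carrier K" obtains X where "represents K X f"
  using assms by (auto simp: rkhs_carrier_def)

lemma rkhs_carrier_add: "f \<in> rkhs_carrier K \<Longrightarrow> g \<in> rkhs_carrier K \<Longrightarrow> (\<lambda>j. f j + g j) \<in> rkhs_carrier K"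
  by (metis rkhs_carrierE rkhs_carrierI represents_add)

lemma rkhs_carrier_diff: "f \<in> rkhs_carrier K \<Longrightarrow> g \<in> rkhs_carrier K \<Longrightarrow> (\<lambda>j. f j - g j) \<in> rkhs_carrier K"
  by (metis rkhs_carrierE rkhs_carrierI represents_diff)

lemma rkhs_carrier_scale: "f \<in> rkhs_carrier K \<Longrightarrow> (\<lambda>j. c * f j) \<in> rkhs_carrier K"
  by (metis rkhs_carrierE rkhs_carrierI represents_scale)

lemma rkhs_carrier_uminus: "f \<in> rkhs_carrier K \<Longrightarrow> (\<lambda>j. - f j) \<in> rkhs_carrier K"
  using rkhs_carrier_scale[of f "-1"] by simp

lemma comb_fun_carrier [simp]: "comb_fun K xs \<in> rkhs_carrier K"
  using represents_const by (rule rkhs_carrierI)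

lemma zero_carrier [simp]: "(\<lambda>_. 0) \<in> rkhs_carrier K"
  using comb_fun_carrier[of "[]"] by (simp add: comb_fun_def[abs_def])

lemma clip_carrier [simp]: "rkhs_clip K f \<in> rkhs_carrier K"
  by (simp add: rkhs_clip_def)

lemma clip_id [simp]: "f \<in> rkhs_carrier K \<Longrightarrow> rkhs_clip K f = f"
  by (simp add: rkhs_clip_def)

lemma inner_add_left:
  assumes "f \<in> rkhs_carrier K" "g \<in> rkhs_carrier K" "h \<in> rkhs_carrier K"
  shows "rkhs_inner K (\<lambda>j. f j + g j) h = rkhs_inner K f h + rkhs_inner K g h"
proof -
  obtain X Y Z where f: "represents K X f" and g: "represents K Y g" and h: "represents K Z h"
    using assms rkhs_carrierE by metis
  have "(\<lambda>n. s (X n) (Z n) + s (Y n) (Z n)) \<longlonglongrightarrow> rkhs_inner K (\<lambda>j. f j + g j) h"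
    using rkhs_inner_tendsto[OF represents_add[OF f g] h] by (simp add: kernel_form_expand)
  moreover have "(\<lambda>n. s (X n) (Z n) + s (Y n) (Z n)) \<longlonglongrightarrow> rkhs_inner K f h + rkhs_inner K g h"
    by (intro tendsto_add rkhs_inner_tendsto f g h)
  ultimately show ?thesis by (rule LIMSEQ_unique)
qed

lemma inner_scale_left:
  assumes "f \<in> rkhs_carrier K" "h \<in> rkhs_carrier K"
  shows "rkhs_inner K (\<lambda>j. c * f j) h = c * rkhs_inner K f h"
proof -
  obtain X Z where f: "represents K X f" and h: "represents K Z h"
    using assms rkhs_carrierE by metis
  have "(\<lambda>n. c * s (X n) (Z n)) \<longlonglongrightarrow> rkhs_inner K (\<lambda>j. c * f j) h"
    using rkhs_inner_tendsto[OF represents_scale[OF f] h] by (simp add: kernel_form_expand)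
  moreover have "(\<lambda>n. c * s (X n) (Z n)) \<longlonglongrightarrow> c * rkhs_inner K f h"
    by (intro tendsto_mult tendsto_const rkhs_inner_tendsto f h)
  ultimately show ?thesis by (rule LIMSEQ_unique)
qed

lemma inner_commute:
  assumes "f \<in> rkhs_carrier K" "g \<in> rkhs_carrier K"
  shows "rkhs_inner K g f = cnj (rkhs_inner K f g)"
proof -
  obtain X Y where f: "represents K X f" and g: "represents K Y g"
    using assms rkhs_carrierE by metis
  have "(\<lambda>n. cnj (s (X n) (Y n))) \<longlonglongrightarrow> cnj (rkhs_inner K f g)"
    by (intro tendsto_cnj rkhs_inner_tendsto f g)
  then have "(\<lambda>n. s (Y n) (X n)) \<longlonglongrightarrow> cnj (rkhs_inner K f g)"
    by (subst form_commute)
  then show ?thesis using rkhs_inner_tendsto[OF g f] LIMSEQ_unique by blast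
qed

lemma inner_self_tendsto:
  assumes "represents K X f"
  shows "(\<lambda>n. (q (X n))\<^sup>2) \<longlonglongrightarrow> Re (rkhs_inner K f f)"
  using tendsto_Re[OF rkhs_inner_tendsto[OF assms assms]] by (simp add: q_power2)

lemma inner_nonneg: "f \<in> rkhs_carrier K \<Longrightarrow> 0 \<le> Re (rkhs_inner K f f)"
  by (metis rkhs_carrierE inner_self_tendsto LIMSEQ_le_const zero_le_power2)

lemma cnorm_tendsto:
  assumes "represents K X f"
  shows "(\<lambda>n. q (X n)) \<longlonglongrightarrow> cnorm (rkhs K) f"
  using tendsto_real_sqrt[OF inner_self_tendsto[OF assms]] by (simp add: cnorm_def)

lemma cnorm_comb_fun: "cnorm (rkhs K) (comb_fun K xs) = q xs"
  using cnorm_tendsto[OF represents_const[of xs]] by (simp add: LIMSEQ_const_iff)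

lemma comb_fun_single: "comb_fun K [(1, i)] = (\<lambda>j. K (i, j))"
  by (simp add: comb_fun_def[abs_def])

lemma kernel_fun_carrier [simp]: "(\<lambda>j. K (i, j)) \<in> rkhs_carrier K"
  using comb_fun_carrier[of "[(1, i)]"] by (simp only: comb_fun_single)

text \<open>
  The reproducing property turns products with kernel functions into values, so that vectors of the
  Hilbert space can be compared pointwise.
\<close>

lemma inner_kernel_fun:
  assumes "f \<in> rkhs_carrier K"
  shows "rkhs_inner K f (\<lambda>j. K (i, j)) = f i"
proof -
  obtain X where f: "represents K X f" using assms rkhs_carrierE by metis
  have "(\<lambda>n. s (X n) [(1, i)]) \<longlonglongrightarrow> rkhs_inner K f (comb_fun K [(1, i)])"
    by (rule rkhs_inner_tendsto[OF f represents_const])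
  moreover have "(\<lambda>n. s (X n) [(1, i)]) \<longlonglongrightarrow> f i"
    using f by (simp add: represents_def comb_fun_def)
  ultimately show ?thesis unfolding comb_fun_single by (rule LIMSEQ_unique)
qed

lemma inner_definite:
  assumes f: "f \<in> rkhs_carrier K" and 0: "rkhs_inner K f f = 0"
  shows "f = (\<lambda>_. 0)"
proof -
  obtain X where X: "represents K X f" using assms rkhs_carrierE by metis
  then have "(\<lambda>n. q (X n)) \<longlonglongrightarrow> 0" using cnorm_tendsto[OF X] 0 by (simp add: cnorm_def)
  then have "(\<lambda>n. comb_fun K (X n) j) \<longlonglongrightarrow> 0" for j
    unfolding comb_fun_def by (rule form_tendsto_0(1)[OF _ comb_Cauchy_const])
  then show ?thesis using X LIMSEQ_unique unfolding represents_def by blast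
qed

text \<open>
  The equation holds for every function \<open>f\<close>. Outside the carrier \<open>f\<close> acts as zero in sums, so its
  unique inverse in the carrier is zero.
\<close>

lemma rkhs_a_inv: "\<ominus>\<^bsub>rkhs K\<^esub> f = (\<lambda>j. - rkhs_clip K f j)"
proof -
  have "(THE g. g \<in> rkhs_carrier K \<and> f \<oplus>\<^bsub>rkhs K\<^esub> g = (\<lambda>_. 0) \<and> g \<oplus>\<^bsub>rkhs K\<^esub> f = (\<lambda>_. 0))
      = (\<lambda>j. - rkhs_clip K f j)"
  proof (rule the_equality)
    show "(\<lambda>j. - rkhs_clip K f j) \<in> rkhs_carrier K \<and>
        f \<oplus>\<^bsub>rkhs K\<^esub> (\<lambda>j. - rkhs_clip K f j) = (\<lambda>_. 0) \<and>
        (\<lambda>j. - rkhs_clip K f j) \<oplus>\<^bsub>rkhs K\<^esub> f = (\<lambda>_. 0)"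
      by (simp add: rkhs_add rkhs_carrier_uminus)
  next
    fix g assume "g \<in> rkhs_carrier K \<and> f \<oplus>\<^bsub>rkhs K\<^esub> g = (\<lambda>_. 0) \<and> g \<oplus>\<^bsub>rkhs K\<^esub> f = (\<lambda>_. 0)"
    then have "rkhs_clip K f j + g j = 0" for j
      by (auto simp: rkhs_add dest: fun_cong[of _ _ j])
    then show "g = (\<lambda>j. - rkhs_clip K f j)" by (auto simp: eq_neg_iff_add_eq_0 add.commute)
  qed
  then show ?thesis by (simp add: a_inv_def m_inv_def)
qed

lemma rkhs_minus: "f \<ominus>\<^bsub>rkhs K\<^esub> g = (\<lambda>j. rkhs_clip K f j - rkhs_clip K g j)"
  by (simp add: a_minus_def rkhs_a_inv rkhs_add rkhs_carrier_uminus)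

lemma rkhs_minus_carrier:
  "f \<in> rkhs_carrier K \<Longrightarrow> g \<in> rkhs_carrier K \<Longrightarrow> f \<ominus>\<^bsub>rkhs K\<^esub> g = (\<lambda>j. f j - g j)"
  by (simp add: rkhs_minus)

lemma inner_uminus:
  assumes "f \<in> rkhs_carrier K"
  shows "rkhs_inner K (\<lambda>j. - f j) (\<lambda>j. - f j) = rkhs_inner K f f"
  using inner_scale_left[of f "\<lambda>j. - f j" "-1"] inner_scale_left[of f f "-1"]
    inner_commute[of f "\<lambda>j. - f j"] inner_commute[of f f] assms rkhs_carrier_uminus[OF assms]
  by (simp add: complex_eq_iff)

sublocale inner_product_space "rkhs K"
proof (unfold inner_product_space_def inner_product_space_axioms_def, intro conjI allI impI)
  show "Module.module complex_field (rkhs K)"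
  proof (rule moduleI)
    show "cring complex_field"
      by (rule cringI; (rule abelian_groupI | rule comm_monoidI)?)
        (auto simp: complex_field_def algebra_simps intro: exI[of _ "- x" for x])
    show "abelian_group (rkhs K)"
    proof (rule abelian_groupI)
      fix f assume "f \<in> carrier (rkhs K)"
      then show "\<exists>g\<in>carrier (rkhs K). g \<oplus>\<^bsub>rkhs K\<^esub> f = \<zero>\<^bsub>rkhs K\<^esub>"
        by (intro bexI[of _ "\<lambda>j. - f j"]) (simp_all add: rkhs_add rkhs_carrier_uminus)
    qed (simp_all add: rkhs_add rkhs_carrier_add algebra_simps)
  qed (simp_all add: rkhs_add rkhs_carrier_add rkhs_carrier_scale complex_field_def algebra_simps)
  fix v w
  show "0 \<le> cdist (rkhs K) v w"
    by (simp add: cdist_def cnorm_def inner_nonneg rkhs_minus rkhs_carrier_diff)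
  show "cdist (rkhs K) v w = cdist (rkhs K) w v"
    using inner_uminus[OF rkhs_carrier_diff[OF clip_carrier clip_carrier], of v w]
    by (simp add: cdist_def cnorm_def rkhs_minus)
qed (simp add: rkhs_add inner_add_left, simp add: inner_scale_left,
    unfold rkhs_simps, erule (1) inner_commute, erule inner_nonneg, erule (1) inner_definite)

text \<open>
  Finite combinations of kernel functions are dense.
\<close>

lemma cdist_comb_fun_tendsto:
  assumes X: "represents K X f"
  shows "(\<lambda>m. cdist (rkhs K) f (comb_fun K (X m))) \<longlonglongrightarrow> 0"
proof (rule LIMSEQ_I)
  fix e :: real assume "e > 0"
  then obtain N where N: "\<And>m n. m \<ge> N \<Longrightarrow> n \<ge> N \<Longrightarrow> q (comb_diff (X m) (X n)) < e / 2"
    using X unfolding represents_def comb_Cauchy_def by (meson half_gt_zero)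
  have "norm (cdist (rkhs K) f (comb_fun K (X m)) - 0) < e" if "m \<ge> N" for m
  proof -
    have f: "f \<in> rkhs_carrier K" using X by (rule rkhs_carrierI)
    have "(\<lambda>n. q (comb_diff (X n) (X m))) \<longlonglongrightarrow> cnorm (rkhs K) (\<lambda>j. f j - comb_fun K (X m) j)"
      by (rule cnorm_tendsto[OF represents_diff[OF X represents_const]])
    then have "cnorm (rkhs K) (\<lambda>j. f j - comb_fun K (X m) j) \<le> e / 2"
      using N that by (intro LIMSEQ_le_const2) (auto intro!: less_imp_le exI[of _ N])
    then have "cdist (rkhs K) f (comb_fun K (X m)) \<le> e / 2"
      using f by (simp add: cdist_def rkhs_minus_carrier)
    then show ?thesis using \<open>e > 0\<close> cdist_nonneg[of f "comb_fun K (X m)"] by simp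
  qed
  then show "\<exists>N. \<forall>m\<ge>N. norm (cdist (rkhs K) f (comb_fun K (X m)) - 0) < e" by blast
qed

lemma cdist_comb_fun: "cdist (rkhs K) (comb_fun K xs) (comb_fun K ys) = q (comb_diff xs ys)"
proof -
  have "cdist (rkhs K) (comb_fun K xs) (comb_fun K ys) =
      cnorm (rkhs K) (\<lambda>j. comb_fun K xs j - comb_fun K ys j)"
    by (simp add: cdist_def rkhs_minus_carrier)
  also have "(\<lambda>j. comb_fun K xs j - comb_fun K ys j) = comb_fun K (comb_diff xs ys)"
    by (rule ext) (simp add: comb_fun_expands)
  finally show ?thesis by (simp only: cnorm_comb_fun)
qed

text \<open>
  A diagonal argument: the \<open>k\<close>-th term of a Cauchy sequence is replaced by a formal combination at
  distance less than \<open>1 / (k + 1)\<close>. The combinations are again Cauchy and so represent a function,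
  which is the limit.
\<close>

theorem rkhs_mcomplete: "Met.mcomplete"
  unfolding Met.mcomplete_def
proof (intro allI impI)
  fix \<sigma> assume cau: "Met.MCauchy \<sigma>"
  then have \<sigma>: "\<sigma> k \<in> rkhs_carrier K" for k unfolding Met.MCauchy_def by auto
  have "\<exists>xs. cdist (rkhs K) (\<sigma> k) (comb_fun K xs) < 1 / real (Suc k)" for k
  proof -
    obtain X where "represents K X (\<sigma> k)" using \<sigma> rkhs_carrierE by metis
    from tendstoD[OF cdist_comb_fun_tendsto[OF this], of "1 / real (Suc k)"]
    have "eventually (\<lambda>m. cdist (rkhs K) (\<sigma> k) (comb_fun K (X m)) < 1 / real (Suc k)) sequentially"
      by simp
    then show ?thesis by (auto simp: eventually_sequentially)
  qed
  then obtain X where X: "cdist (rkhs K) (\<sigma> k) (comb_fun K (X k)) < 1 / real (Suc k)" for k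
    by metis
  have tri: "cdist (rkhs K) f h \<le> cdist (rkhs K) f g + cdist (rkhs K) g h"
    if "f \<in> rkhs_carrier K" "g \<in> rkhs_carrier K" "h \<in> rkhs_carrier K" for f g h
    using cdist_triangle that by simp
  have cauX: "comb_Cauchy K X"
    unfolding comb_Cauchy_def
  proof (intro allI impI)
    fix e :: real assume "e > 0"
    then have "e / 3 > 0" by simp
    obtain N1 where N1: "\<And>m n. N1 \<le> m \<Longrightarrow> N1 \<le> n \<Longrightarrow> cdist (rkhs K) (\<sigma> m) (\<sigma> n) < e / 3"
      using cau \<open>e / 3 > 0\<close> unfolding Met.MCauchy_def by blast
    obtain N2 where N2: "1 / real (Suc N2) < e / 3"
      using nat_approx_posE[OF \<open>e / 3 > 0\<close>] by blast
    have "q (comb_diff (X m) (X n)) < e" if mn: "m \<ge> max N1 N2" "n \<ge> max N1 N2" for m n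
    proof -
      have "q (comb_diff (X m) (X n)) = cdist (rkhs K) (comb_fun K (X m)) (comb_fun K (X n))"
        by (simp add: cdist_comb_fun)
      also have "\<dots> \<le> cdist (rkhs K) (comb_fun K (X m)) (\<sigma> m)
          + (cdist (rkhs K) (\<sigma> m) (\<sigma> n) + cdist (rkhs K) (\<sigma> n) (comb_fun K (X n)))"
        using tri[of "comb_fun K (X m)" "\<sigma> m" "comb_fun K (X n)"] tri[of "\<sigma> m" "\<sigma> n" "comb_fun K (X n)"] \<sigma>
        by simp
      also have "\<dots> < 1 / real (Suc m) + (e / 3 + 1 / real (Suc n))"
        using X[of m] X[of n] N1[of m n] mn cdist_commute[of "comb_fun K (X m)" "\<sigma> m"] by simp
      also have "\<dots> \<le> 1 / real (Suc N2) + (e / 3 + 1 / real (Suc N2))"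
        using mn by (intro add_mono) (auto simp: frac_le)
      also have "\<dots> < e" using N2 by simp
      finally show ?thesis .
    qed
    then show "\<exists>N. \<forall>m\<ge>N. \<forall>n\<ge>N. q (comb_diff (X m) (X n)) < e" by blast
  qed
  have "convergent (\<lambda>n. comb_fun K (X n) j)" for j
    unfolding comb_fun_def by (rule form_Cauchy_convergent[OF cauX comb_Cauchy_const])
  then obtain f where "\<And>j. (\<lambda>n. comb_fun K (X n) j) \<longlonglongrightarrow> f j"
    unfolding convergent_def by metis
  then have f: "represents K X f" using cauX by (simp add: represents_def)
  then have fK: "f \<in> rkhs_carrier K" by (rule rkhs_carrierI)
  have lim: "(\<lambda>k. 1 / real (Suc k) + cdist (rkhs K) f (comb_fun K (X k))) \<longlonglongrightarrow> 0 + 0"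
    by (intro tendsto_add LIMSEQ_Suc[OF lim_1_over_n] cdist_comb_fun_tendsto f)
  have le: "cdist (rkhs K) (\<sigma> k) f \<le> 1 / real (Suc k) + cdist (rkhs K) f (comb_fun K (X k))" for k
    using tri[OF \<sigma>[of k] comb_fun_carrier[of "X k"] fK] X[of k] cdist_commute[of f "comb_fun K (X k)"]
    by linarith
  have "(\<lambda>k. cdist (rkhs K) (\<sigma> k) f) \<longlonglongrightarrow> 0"
  proof (rule Lim_null_comparison)
    show "\<forall>\<^sub>F k in sequentially. norm (cdist (rkhs K) (\<sigma> k) f) \<le>
        1 / real (Suc k) + cdist (rkhs K) f (comb_fun K (X k))"
      unfolding real_norm_def abs_of_nonneg[OF cdist_nonneg] by (rule always_eventually) (blast intro: le)
  qed (use lim in simp)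
  then have "limitin Met.mtopology \<sigma> f sequentially"
    unfolding Met.limitin_metric_dist_null using fK \<sigma> by simp
  then show "\<exists>f. limitin Met.mtopology \<sigma> f sequentially" by blast
qed

lemma rkhs_hilbert: "complex_hilbert_space (rkhs K)"
  by (rule complex_hilbert_spaceI[OF rkhs_mcomplete])

lemma comb_fun_in_submodule:
  assumes W: "submodule W complex_field (rkhs K)" and e: "\<And>i. (\<lambda>j. K (i, j)) \<in> W"
  shows "comb_fun K xs \<in> W"
proof (induction xs)
  case Nil
  have "comb_fun K [] = \<zero>\<^bsub>rkhs K\<^esub>" by (simp add: comb_fun_def[abs_def])
  then show ?case using subgroup.one_closed[OF submodule.axioms(1)[OF W]] by simp
next
  case (Cons x xs)
  obtain a i where x: "x = (a, i)" by fastforce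
  have "comb_fun K (x # xs) = a \<odot>\<^bsub>rkhs K\<^esub> (\<lambda>j. K (i, j)) \<oplus>\<^bsub>rkhs K\<^esub> comb_fun K xs"
    by (auto simp: x rkhs_add rkhs_carrier_scale comb_fun_def kernel_form_Cons_left[of _ "(a, i)"])
  moreover have "a \<odot>\<^bsub>rkhs K\<^esub> (\<lambda>j. K (i, j)) \<in> W"
    using submoduleE(4)[OF W _ e, of a i] by (simp add: complex_field_def)
  ultimately show ?case using submoduleE(5)[OF W _ Cons.IH] by simp
qed

lemma closed_submodule_eq_carrier:
  assumes W: "submodule W complex_field (rkhs K)" and closed: "closedin (norm_topology (rkhs K)) W"
    and e: "\<And>i. (\<lambda>j. K (i, j)) \<in> W"
  shows "W = carrier (rkhs K)"
proof
  show "W \<subseteq> carrier (rkhs K)" using submoduleE(1)[OF W] .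
  show "carrier (rkhs K) \<subseteq> W"
  proof
    fix f assume f: "f \<in> carrier (rkhs K)"
    then obtain X where X: "represents K X f" using rkhs_carrierE by auto
    have "(\<lambda>m. cdist (rkhs K) (comb_fun K (X m)) f) \<longlonglongrightarrow> 0"
      using cdist_comb_fun_tendsto[OF X] by (subst cdist_commute)
    then have "limitin Met.mtopology (\<lambda>m. comb_fun K (X m)) f sequentially"
      unfolding Met.limitin_metric_dist_null using f by simp
    then show "f \<in> W"
      using closed comb_fun_in_submodule[OF W e] by (auto simp: norm_topology_eq intro: limitin_closedin)
  qed
qed

end

section \<open>Extreme kernels\<close>

lemma convex_combination_norm_square:
  fixes a b :: complex and t :: real
  shows "(cmod (of_real t * a + (1 - of_real t) * b))\<^sup>2 =
    t * (cmod a)\<^sup>2 + (1 - t) * (cmod b)\<^sup>2 - t * (1 - t) * (cmod (a - b))\<^sup>2"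
  by (simp add: cmod_power2) (simp add: power2_eq_square algebra_simps)

text \<open>
  A strictly convex function attains its maximum over a convex set at extreme points only. Over a
  countable index set the weighted sum of squares \<open>E\<close> is finite, continuous and strictly convex.
  Subtracting three times the real part of the coordinate \<open>k0\<close> preserves this and rules out maxima
  with \<open>\<phi> k0 = 1\<close>: there the value is at most \<open>2 - 3\<close>, while it is nonnegative at \<open>\<phi>0\<close>.
\<close>

theorem exists_extreme_point:
  fixes S :: "('k::countable \<Rightarrow> complex) set"
  assumes compact: "compact S"
    and bounded: "\<And>\<phi> k. \<phi> \<in> S \<Longrightarrow> cmod (\<phi> k) \<le> 1"
    and \<phi>0: "\<phi>0 \<in> S" "\<phi>0 k0 = 0"
  shows "\<exists>\<phi>\<in>S. \<phi> k0 \<noteq> 1 \<and>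
    (\<forall>\<phi>1\<in>S. \<forall>\<phi>2\<in>S. \<forall>t::real. 0 < t \<and> t < 1 \<and>
      (\<forall>k. \<phi> k = of_real t * \<phi>1 k + (1 - of_real t) * \<phi>2 k) \<longrightarrow> \<phi>1 = \<phi>2)"
proof -
  define w where "w \<phi> n = (1/2) ^ n * (cmod (\<phi> (from_nat n :: 'k)))\<^sup>2" for \<phi> n
  define E where "E \<phi> = (\<Sum>n. w \<phi> n)" for \<phi>
  define f where "f \<phi> = E \<phi> - 3 * Re (\<phi> k0)" for \<phi>
  have geo: "summable (\<lambda>n. (1/2::real) ^ n)" by simp
  have w_le: "w \<phi> n \<le> (1/2) ^ n" if "\<phi> \<in> S" for \<phi> n
    using bounded[OF that, of "from_nat n"] by (simp add: w_def power_le_one)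
  have w_nonneg: "0 \<le> w \<phi> n" for \<phi> n by (simp add: w_def)
  have summable: "summable (w \<phi>)" if "\<phi> \<in> S" for \<phi>
    by (rule summable_comparison_test'[OF geo, of 0]) (use w_le[OF that] w_nonneg in auto)
  have "uniform_limit S (\<lambda>n \<phi>. \<Sum>i<n. w \<phi> i) E sequentially"
    unfolding E_def by (rule Weierstrass_m_test[OF _ geo]) (use w_le w_nonneg in auto)
  then have "continuous_on S E"
    by (rule uniform_limit_theorem[rotated])
      (auto simp: w_def intro!: always_eventually continuous_intros
        continuous_on_subset[OF continuous_on_product_coordinates])
  then have "continuous_on S f"
    unfolding f_def
    by (auto intro!: continuous_intros continuous_on_subset[OF continuous_on_product_coordinates])
  then obtain \<phi> where \<phi>: "\<phi> \<in> S" and max: "\<And>\<psi>. \<psi> \<in> S \<Longrightarrow> f \<psi> \<le> f \<phi>"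
    using continuous_attains_sup[OF compact] \<phi>0 by (metis empty_iff)
  have "\<phi> k0 \<noteq> 1"
  proof
    assume 1: "\<phi> k0 = 1"
    have "E \<phi> \<le> (\<Sum>n. (1/2) ^ n)"
      unfolding E_def by (intro suminf_le w_le summable geo \<phi>)
    then have "E \<phi> \<le> 2" by (simp add: suminf_geometric)
    moreover have "0 \<le> E \<phi>0"
      unfolding E_def by (intro suminf_nonneg summable w_nonneg \<phi>0)
    ultimately show False using max[OF \<phi>0(1)] 1 \<phi>0(2) by (simp add: f_def)
  qed
  moreover have "\<phi>1 = \<phi>2"
    if \<phi>12: "\<phi>1 \<in> S" "\<phi>2 \<in> S" and t: "0 < t" "t < 1"
      and comb: "\<And>k. \<phi> k = of_real t * \<phi>1 k + (1 - of_real t) * \<phi>2 k" for \<phi>1 \<phi>2 and t :: real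
  proof -
    let ?d = "\<lambda>k. \<phi>1 k - \<phi>2 k"
    \<comment> \<open>The defect of convexity is the same multiple of the squared difference in every coordinate.\<close>
    have w_comb: "t * (1 - t) * w ?d n = t * w \<phi>1 n + (1 - t) * w \<phi>2 n - w \<phi> n" for n
      unfolding w_def comb convex_combination_norm_square by (simp add: algebra_simps)
    have "summable (\<lambda>n. t * (1 - t) * w ?d n)"
      unfolding w_comb by (intro summable_add summable_diff summable_mult summable \<phi>12 \<phi>)
    then have sum_d: "summable (w ?d)"
      using t summable_mult_D[of "t * (1 - t)"] by fastforce
    have "t * (1 - t) * E ?d = (\<Sum>n. t * (1 - t) * w ?d n)"
      unfolding E_def by (rule suminf_mult[OF sum_d, symmetric])
    also have "\<dots> = t * E \<phi>1 + (1 - t) * E \<phi>2 - E \<phi>"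
      unfolding w_comb E_def
      by (simp add: suminf_mult suminf_add[symmetric] suminf_diff[symmetric] summable_add summable_mult
          summable \<phi>12 \<phi>)
    also have "\<dots> = t * f \<phi>1 + (1 - t) * f \<phi>2 - f \<phi>"
      by (simp add: f_def comb algebra_simps)
    also have "\<dots> \<le> 0"
      using max[OF \<phi>12(1)] max[OF \<phi>12(2)] t convex_bound_le[of "f \<phi>1" "f \<phi>" "f \<phi>2" t "1 - t"] by simp
    finally have "E ?d \<le> 0" using t by (simp add: mult_le_0_iff)
    moreover have "0 \<le> E ?d" unfolding E_def by (intro suminf_nonneg sum_d w_nonneg)
    ultimately have "(\<Sum>n. w ?d n) = 0" by (simp add: E_def)
    then have "w ?d n = 0" for n
      using suminf_eq_zero_iff[OF sum_d] w_nonneg by blast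
    then have "w ?d (to_nat k) = 0" for k :: 'k by blast
    then have "\<phi>1 k = \<phi>2 k" for k by (simp add: w_def)
    then show "\<phi>1 = \<phi>2" by (rule ext)
  qed
  ultimately show ?thesis using \<phi> by blast
qed

lemma psd_kernelI:
  assumes "\<And>i j. K (j, i) = cnj (K (i, j))" "\<And>xs. 0 \<le> Re (kernel_form K xs xs)"
  shows "psd_kernel K"
  unfolding psd_kernel_def using assms by blast

lemma psd_kernel_commute: "psd_kernel K \<Longrightarrow> K (j, i) = cnj (K (i, j))"
  unfolding psd_kernel_def by blast

lemma psd_kernel_diag:
  assumes "psd_kernel K"
  shows "Im (K (i, i)) = 0" "0 \<le> Re (K (i, i))"
proof -
  show "Im (K (i, i)) = 0"
    using arg_cong[OF psd_kernel_commute[OF assms, of i i], of Im] by simp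
  have "0 \<le> Re (kernel_form K [(1, i)] [(1, i)])"
    using assms unfolding psd_kernel_def by blast
  then show "0 \<le> Re (K (i, i))" by simp
qed

text \<open>
  The Cauchy-Schwarz inequality for two basis symbols. It bounds a whole kernel by its diagonal, so
  that a kernel with zero diagonal vanishes.
\<close>

lemma psd_kernel_bound:
  assumes "psd_kernel K"
  shows "cmod (K (i, j)) \<le> sqrt (Re (K (i, i))) * sqrt (Re (K (j, j)))"
  using positive_kernel.form_Cauchy_Schwarz[of K "[(1, i)]" "[(1, j)]"] assms
  by (simp add: positive_kernel_def comb_seminorm_def)

lemma psd_kernel_eq_0:
  assumes "psd_kernel K" "\<And>i. K (i, i) = 0"
  shows "K = (\<lambda>_. 0)"
  using psd_kernel_bound[OF assms(1)] assms(2) by auto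

lemma psd_kernel_scale:
  assumes K: "psd_kernel K" and "0 \<le> c"
  shows "psd_kernel (\<lambda>x. of_real c * K x)"
proof (rule psd_kernelI)
  show "of_real c * K (j, i) = cnj (of_real c * K (i, j))" for i j
    using psd_kernel_commute[OF K, of j i] by simp
  show "0 \<le> Re (kernel_form (\<lambda>x. of_real c * K x) xs xs)" for xs
  proof -
    have "0 \<le> Re (kernel_form K xs xs)" using K unfolding psd_kernel_def by blast
    then show ?thesis using \<open>0 \<le> c\<close> by (simp add: kernel_form_mult_kernel)
  qed
qed

definition invariant_kernel :: "('i \<Rightarrow> 'i) set \<Rightarrow> ('i \<times> 'i \<Rightarrow> complex) \<Rightarrow> bool"
  where "invariant_kernel A K \<longleftrightarrow> (\<forall>a\<in>A. \<forall>i j. K (a i, a j) = K (i, j))"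

text \<open>
  The diagonal condition makes such a kernel vanish outside \<open>T \<times> T\<close>. When \<open>A\<close> is a permutation group and \<open>T\<close>
  one of its orbits, these kernels are the positive definite functions on the group that equal \<open>1\<close> on a
  point stabilizer.
\<close>

definition normalized_kernels :: "('i \<Rightarrow> 'i) set \<Rightarrow> 'i set \<Rightarrow> ('i \<times> 'i \<Rightarrow> complex) set"
  where "normalized_kernels A T =
    {K. psd_kernel K \<and> invariant_kernel A K \<and> (\<forall>i. K (i, i) = of_bool (i \<in> T))}"

lemma normalized_kernels_bound:
  assumes "K \<in> normalized_kernels A T" shows "cmod (K x) \<le> 1"
proof -
  obtain i j where x: "x = (i, j)" by fastforce
  show ?thesis
    using psd_kernel_bound[of K i j] assms by (auto simp: x normalized_kernels_def of_bool_def split: if_splits)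
qed

lemma continuous_on_kernel_form: "continuous_on UNIV (\<lambda>K. kernel_form K xs ys)"
proof (induction xs)
  case (Cons x xs)
  obtain a i where x: "x = (a, i)" by fastforce
  have "continuous_on UNIV (\<lambda>K. kernel_form K [(a, i)] ys)"
  proof (induction ys)
    case (Cons y ys)
    obtain b j where y: "y = (b, j)" by fastforce
    have "continuous_on UNIV (\<lambda>K. kernel_form K [(a, i)] [(b, j)])"
      by (auto intro!: continuous_intros)
    then show ?case
      unfolding y kernel_form_Cons_right[of _ _ "(b, j)" ys] using Cons.IH by (rule continuous_on_add)
  qed simp
  then show ?case
    unfolding x kernel_form_Cons_left[of _ "(a, i)" xs] using Cons.IH by (rule continuous_on_add)
qed simp

lemma compact_unit_polydisc: "compact {\<phi> :: 'k \<Rightarrow> complex. \<forall>k. cmod (\<phi> k) \<le> 1}"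
proof -
  have "compactin (product_topology (\<lambda>_. euclidean) UNIV) (PiE UNIV (\<lambda>_ :: 'k. cball (0::complex) 1))"
    by (simp add: compactin_PiE)
  then have "compact (PiE UNIV (\<lambda>_ :: 'k. cball (0::complex) 1))"
    by (simp add: euclidean_product_topology)
  also have "PiE UNIV (\<lambda>_ :: 'k. cball (0::complex) 1) = {\<phi>. \<forall>k. cmod (\<phi> k) \<le> 1}"
    by (auto simp: PiE_def Pi_def)
  finally show ?thesis .
qed

lemma compact_normalized_kernels: "compact (normalized_kernels A T)"
proof -
  have "closed (normalized_kernels A T)"
    unfolding normalized_kernels_def psd_kernel_def invariant_kernel_def Ball_def
    by (intro closed_Collect_conj closed_Collect_all closed_Collect_imp open_Collect_const closed_Collect_eq
        closed_Collect_le continuous_intros continuous_on_kernel_form continuous_on_product_coordinates)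
  moreover have "normalized_kernels A T = {\<phi>. \<forall>k. cmod (\<phi> k) \<le> 1} \<inter> normalized_kernels A T"
    using normalized_kernels_bound by blast
  ultimately show ?thesis
    using compact_Int_closed[OF compact_unit_polydisc] by metis
qed

text \<open>
  The form of this kernel is the sum over \<open>T\<close> of \<open>|c k|\<^sup>2\<close>, where \<open>c k\<close> is the total coefficient of
  the symbol \<open>k\<close> in a formal combination.
\<close>

lemma psd_kernel_delta: "psd_kernel (\<lambda>(i, j). of_bool (i = j \<and> i \<in> T))" (is "psd_kernel ?K")
proof (rule psd_kernelI)
  fix xs :: "(complex \<times> 'a) list"
  define c where "c ys k = (\<Sum>(a, i)\<leftarrow>ys. if i = k then a else 0)" for ys :: "(complex \<times> 'a) list" and k
  define F where "F = snd ` set xs \<inter> T"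
  have F: "finite F" by (simp add: F_def)
  have c_simps [simp]: "c [] k = 0" "c ((a, i) # ys) k = (if i = k then a else 0) + c ys k" for a i ys k
    by (simp_all add: c_def)
  have single: "kernel_form ?K [(a, i)] ys = (if i \<in> T then a * cnj (c ys i) else 0)" for a i ys
  proof (induction ys)
    case (Cons y ys)
    obtain b j where y: "y = (b, j)" by fastforce
    show ?case
      unfolding y kernel_form_Cons_right[of _ _ "(b, j)" ys] Cons.IH
      by (auto simp: algebra_simps)
  qed simp
  have "kernel_form ?K ys xs = (\<Sum>k\<in>F. c ys k * cnj (c xs k))" if "snd ` set ys \<subseteq> snd ` set xs" for ys
    using that
  proof (induction ys)
    case (Cons y ys)
    obtain a i where y: "y = (a, i)" by fastforce
    have "(\<Sum>k\<in>F. (if i = k then a else 0) * cnj (c xs k)) = (\<Sum>k\<in>F. if i = k then a * cnj (c xs k) else 0)"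
      by (intro sum.cong) auto
    also have "\<dots> = (if i \<in> T then a * cnj (c xs i) else 0)"
      using Cons.prems F by (auto simp: y F_def)
    finally show ?case
      unfolding y kernel_form_Cons_left[of _ "(a, i)" ys] single
      using Cons by (simp add: distrib_right sum.distrib y)
  qed simp
  then have "kernel_form ?K xs xs = (\<Sum>k\<in>F. of_real ((cmod (c xs k))\<^sup>2))"
    by (simp only: complex_norm_square)
  then show "0 \<le> Re (kernel_form ?K xs xs)" by (simp add: sum_nonneg)
qed auto

lemma delta_in_normalized_kernels:
  assumes "\<And>a. a \<in> A \<Longrightarrow> inj a" "\<And>a i. a \<in> A \<Longrightarrow> a i \<in> T \<longleftrightarrow> i \<in> T"
  shows "(\<lambda>(i, j). of_bool (i = j \<and> i \<in> T)) \<in> normalized_kernels A T"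
  using psd_kernel_delta assms by (auto simp: normalized_kernels_def invariant_kernel_def inj_eq)

definition extreme_kernel :: "('i \<Rightarrow> 'i) set \<Rightarrow> 'i set \<Rightarrow> ('i \<times> 'i \<Rightarrow> complex) \<Rightarrow> bool"
  where "extreme_kernel A T K \<longleftrightarrow> K \<in> normalized_kernels A T \<and>
    (\<forall>K1\<in>normalized_kernels A T. \<forall>K2\<in>normalized_kernels A T. \<forall>t::real. 0 < t \<and> t < 1 \<and>
      (\<forall>x. K x = of_real t * K1 x + (1 - of_real t) * K2 x) \<longrightarrow> K1 = K2)"

lemma exists_extreme_kernel:
  fixes A :: "('i::countable \<Rightarrow> 'i) set"
  assumes "\<And>a. a \<in> A \<Longrightarrow> inj a" "\<And>a i. a \<in> A \<Longrightarrow> a i \<in> T \<longleftrightarrow> i \<in> T" and "u \<noteq> v"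
  shows "\<exists>K. extreme_kernel A T K \<and> K (u, v) \<noteq> 1"
proof -
  have "(\<lambda>(i, j). of_bool (i = j \<and> i \<in> T)) \<in> normalized_kernels A T"
    using assms by (intro delta_in_normalized_kernels)
  moreover have "(\<lambda>(i, j). of_bool (i = j \<and> i \<in> T)) (u, v) = (0 :: complex)"
    using \<open>u \<noteq> v\<close> by simp
  ultimately obtain K where "K \<in> normalized_kernels A T" "K (u, v) \<noteq> 1"
    "\<forall>K1\<in>normalized_kernels A T. \<forall>K2\<in>normalized_kernels A T. \<forall>t::real. 0 < t \<and> t < 1 \<and>
      (\<forall>x. K x = of_real t * K1 x + (1 - of_real t) * K2 x) \<longrightarrow> K1 = K2"
    using exists_extreme_point[of "normalized_kernels A T" "\<lambda>(i, j). of_bool (i = j \<and> i \<in> T)" "(u, v)"]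
      compact_normalized_kernels[of A T] normalized_kernels_bound[of _ A T] by blast
  then show ?thesis unfolding extreme_kernel_def by blast
qed

text \<open>
  By transitivity the diagonal of \<open>K1\<close> is a constant \<open>t\<close> on \<open>T\<close> and that of \<open>K2\<close> is \<open>1 - t\<close>. For
  \<open>0 < t < 1\<close> the rescaled kernels \<open>K1 / t\<close> and \<open>K2 / (1 - t)\<close> are normalized with convex
  combination \<open>K\<close>, so they coincide with \<open>K\<close>. For \<open>t = 0\<close> and \<open>t = 1\<close> one summand has zero
  diagonal and therefore vanishes.
\<close>

theorem extreme_kernel_summand:
  assumes ext: "extreme_kernel A T K"
    and psd: "psd_kernel K1" "psd_kernel K2"
    and inv: "invariant_kernel A K1" "invariant_kernel A K2"
    and sum: "\<And>x. K x = K1 x + K2 x"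
    and p: "p \<in> T"
    and trans: "\<And>i j. i \<in> T \<Longrightarrow> j \<in> T \<Longrightarrow> \<exists>a\<in>A. a i = j"
  shows "\<exists>t::real. \<forall>x. K1 x = of_real t * K x"
proof -
  have K: "K \<in> normalized_kernels A T" using ext by (simp add: extreme_kernel_def)
  then have K_diag: "K (i, i) = of_bool (i \<in> T)" for i by (simp add: normalized_kernels_def)
  define t where "t = Re (K1 (p, p))"
  have diag: "L (i, i) = (if i \<in> T then of_real (Re (L (p, p))) else 0)"
    if L: "L = K1 \<or> L = K2" for L i
  proof (cases "i \<in> T")
    case True
    then obtain a where "a \<in> A" "a p = i" using trans p by blast
    have "L (a p, a p) = L (p, p)"
      using L inv \<open>a \<in> A\<close> unfolding invariant_kernel_def by blast
    then have "L (i, i) = L (p, p)" unfolding \<open>a p = i\<close> .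
    moreover have "Im (L (p, p)) = 0" using L psd_kernel_diag(1)[OF psd(1), of p] psd_kernel_diag(1)[OF psd(2), of p] by auto
    ultimately have "L (i, i) = of_real (Re (L (p, p)))" by (intro complex_eqI) simp_all
    then show ?thesis using True by simp
  next
    case False
    then have "Re (K1 (i, i)) + Re (K2 (i, i)) = 0"
      using arg_cong[OF sum[of "(i, i)"], of Re] K_diag[of i] by simp
    then have "Re (K1 (i, i)) = 0" "Re (K2 (i, i)) = 0"
      using psd_kernel_diag(2)[OF psd(1), of i] psd_kernel_diag(2)[OF psd(2), of i] by linarith+
    then have "L (i, i) = 0"
      using L psd_kernel_diag(1)[OF psd(1), of i] psd_kernel_diag(1)[OF psd(2), of i]
      by (auto intro: complex_eqI)
    then show ?thesis using False by simp
  qed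
  have Re_p: "Re (K1 (p, p)) + Re (K2 (p, p)) = 1"
    using arg_cong[OF sum[of "(p, p)"], of Re] K_diag[of p] p by simp
  have diag1: "K1 (i, i) = of_real t * of_bool (i \<in> T)" for i using diag[of K1 i] by (simp add: t_def)
  have diag2: "K2 (i, i) = of_real (1 - t) * of_bool (i \<in> T)" for i
  proof -
    have "Re (K2 (p, p)) = 1 - t" using Re_p by (simp add: t_def)
    then show ?thesis using diag[of K2 i] by simp
  qed
  have t01: "0 \<le> t" "t \<le> 1" using psd_kernel_diag(2)[OF psd(1), of p] psd_kernel_diag(2)[OF psd(2), of p] Re_p
    by (auto simp: t_def)
  consider "t = 0" | "t = 1" | "0 < t" "t < 1" using t01 by linarith
  then show ?thesis
  proof cases
    case 1
    then have "K1 = (\<lambda>_. 0)" using psd_kernel_eq_0[OF psd(1)] diag1 by simp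
    then show ?thesis by (intro exI[of _ 0]) simp
  next
    case 2
    then have "K2 = (\<lambda>_. 0)" using psd_kernel_eq_0[OF psd(2)] diag2 by simp
    then show ?thesis using sum by (intro exI[of _ 1]) simp
  next
    case 3
    define L1 where "L1 = (\<lambda>x. of_real (1 / t) * K1 x)"
    define L2 where "L2 = (\<lambda>x. of_real (1 / (1 - t)) * K2 x)"
    have "L1 \<in> normalized_kernels A T"
      using psd_kernel_scale[OF psd(1), of "1 / t"] inv(1) 3
      by (simp add: normalized_kernels_def L1_def invariant_kernel_def diag1)
    moreover have "L2 \<in> normalized_kernels A T"
      using psd_kernel_scale[OF psd(2), of "1 / (1 - t)"] inv(2) 3
      by (simp add: normalized_kernels_def L2_def invariant_kernel_def diag2)
    moreover have L: "K x = of_real t * L1 x + (1 - of_real t) * L2 x" for x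
      using 3 sum[of x] by (simp add: L1_def L2_def field_simps)
    ultimately have "L1 = L2" using ext 3 unfolding extreme_kernel_def by blast
    then have "K x = L1 x" for x using L[of x] by (simp add: algebra_simps)
    then have "K1 x = of_real t * K x" for x using 3 by (simp add: L1_def)
    then show ?thesis by blast
  qed
qed

section \<open>The translation representation\<close>

lemma (in inner_product_space) orthogonal_projection_unique:
  assumes sub: "submodule W complex_field H" and v: "v \<in> carrier H"
    and p: "p \<in> W" "\<And>w. w \<in> W \<Longrightarrow> cinner H (v \<ominus> p) w = 0"
    and p': "p' \<in> W" "\<And>w. w \<in> W \<Longrightarrow> cinner H (v \<ominus> p') w = 0"
  shows "p = p'"
proof -
  have WH: "W \<subseteq> carrier H" using submoduleE(1)[OF sub] .
  have H: "p \<in> carrier H" "p' \<in> carrier H" using p(1) p'(1) WH by auto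
  have "p \<ominus> p' \<in> W"
    using submoduleE(5)[OF sub p(1) submoduleE(3)[OF sub p'(1)]] by (simp only: M.minus_eq)
  from p(2)[OF this] p'(2)[OF this] have "cinner H (p \<ominus> p') (p \<ominus> p') = 0"
    using H v by (simp add: cinner_diff_left)
  then have "cdist H p p' = 0" by (simp add: cdist_def cnorm_def)
  then show ?thesis using Met.zero[OF H] by blast
qed

text \<open>
  Invariance of the kernel makes the shift of indices an isometry of the formal combinations, and it
  is transported to the functions which they induce.
\<close>

locale invariant_positive_kernel = positive_kernel K + Gam: group \<Gamma>
  for K :: "'i \<times> 'i \<Rightarrow> complex" and \<Gamma> :: "'g monoid" +
  fixes act :: "'g \<Rightarrow> 'i \<Rightarrow> 'i"
  assumes act_one: "act \<one>\<^bsub>\<Gamma>\<^esub> i = i"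
    and act_mult: "g \<in> carrier \<Gamma> \<Longrightarrow> h \<in> carrier \<Gamma> \<Longrightarrow> act (g \<otimes>\<^bsub>\<Gamma>\<^esub> h) i = act g (act h i)"
    and invariant: "g \<in> carrier \<Gamma> \<Longrightarrow> K (act g i, act g j) = K (i, j)"
begin

lemma act_inv [simp]:
  assumes "g \<in> carrier \<Gamma>"
  shows "act (inv\<^bsub>\<Gamma>\<^esub> g) (act g i) = i" "act g (act (inv\<^bsub>\<Gamma>\<^esub> g) i) = i"
  using assms act_mult[of "inv\<^bsub>\<Gamma>\<^esub> g" g i] act_mult[of g "inv\<^bsub>\<Gamma>\<^esub> g" i] by (simp_all add: act_one)

text \<open>
  Restricted to the carrier, as the elements of \<^const>\<open>Bij\<close> are extensional functions.
\<close>

definition translation :: "'g \<Rightarrow> ('i \<Rightarrow> complex) \<Rightarrow> 'i \<Rightarrow> complex"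
  where "translation g = (\<lambda>f\<in>rkhs_carrier K. \<lambda>j. f (act (inv\<^bsub>\<Gamma>\<^esub> g) j))"

abbreviation shift :: "'g \<Rightarrow> (complex \<times> 'i) list \<Rightarrow> (complex \<times> 'i) list"
  where "shift g \<equiv> map (apsnd (act g))"

lemma form_shift: "g \<in> carrier \<Gamma> \<Longrightarrow> s (shift g xs) (shift g ys) = s xs ys"
  by (simp add: kernel_form_map invariant)

lemma comb_fun_shift:
  assumes "g \<in> carrier \<Gamma>"
  shows "comb_fun K (shift g xs) j = comb_fun K xs (act (inv\<^bsub>\<Gamma>\<^esub> g) j)"
  using form_shift[OF assms, of xs "[(1, act (inv\<^bsub>\<Gamma>\<^esub> g) j)]"] assms by (simp add: comb_fun_def)

lemma shift_diff: "comb_diff (shift g xs) (shift g ys) = shift g (comb_diff xs ys)"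
  by (auto simp: comb_diff_def scale_comb_def)

lemma represents_translation:
  assumes g: "g \<in> carrier \<Gamma>" and X: "represents K X f"
  shows "represents K (\<lambda>n. shift g (X n)) (translation g f)"
proof -
  have "q (shift g xs) = q xs" for xs
    using g by (intro q_cong form_shift)
  then have "comb_Cauchy K (\<lambda>n. shift g (X n))"
    using X by (simp add: represents_def comb_Cauchy_def shift_diff)
  then show ?thesis
    using X g rkhs_carrierI[OF X] by (simp add: represents_def comb_fun_shift translation_def)
qed

lemma translation_carrier [simp]:
  "g \<in> carrier \<Gamma> \<Longrightarrow> f \<in> rkhs_carrier K \<Longrightarrow> translation g f \<in> rkhs_carrier K"
  by (meson rkhs_carrierE rkhs_carrierI represents_translation)

lemma translation_apply:
  "f \<in> rkhs_carrier K \<Longrightarrow> translation g f j = f (act (inv\<^bsub>\<Gamma>\<^esub> g) j)"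
  by (simp add: translation_def)

lemma translation_comb_fun:
  "g \<in> carrier \<Gamma> \<Longrightarrow> translation g (comb_fun K xs) = comb_fun K (shift g xs)"
  by (rule ext) (simp add: comb_fun_shift translation_apply)

lemma translation_kernel_fun:
  assumes "g \<in> carrier \<Gamma>"
  shows "translation g (\<lambda>j. K (i, j)) = (\<lambda>j. K (act g i, j))"
  using translation_comb_fun[OF assms, of "[(1, i)]"] by (simp add: comb_fun_single)

lemma inner_translation:
  assumes g: "g \<in> carrier \<Gamma>" and fh: "f \<in> rkhs_carrier K" "h \<in> rkhs_carrier K"
  shows "rkhs_inner K (translation g f) (translation g h) = rkhs_inner K f h"
proof -
  obtain X Y where f: "represents K X f" and h: "represents K Y h"
    using fh rkhs_carrierE by metis
  have "(\<lambda>n. s (X n) (Y n)) \<longlonglongrightarrow> rkhs_inner K (translation g f) (translation g h)"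
    using rkhs_inner_tendsto[OF represents_translation[OF g f] represents_translation[OF g h]]
    by (simp add: form_shift g)
  then show ?thesis using rkhs_inner_tendsto[OF f h] LIMSEQ_unique by blast
qed

lemma translation_mult:
  assumes "g \<in> carrier \<Gamma>" "h \<in> carrier \<Gamma>" "f \<in> rkhs_carrier K"
  shows "translation (g \<otimes>\<^bsub>\<Gamma>\<^esub> h) f = translation g (translation h f)"
  using assms by (intro ext) (simp add: translation_apply Gam.inv_mult_group act_mult)

lemma translation_one: "f \<in> rkhs_carrier K \<Longrightarrow> translation \<one>\<^bsub>\<Gamma>\<^esub> f = f"
  by (rule ext) (simp add: translation_apply act_one)

lemma translation_inv [simp]:
  assumes "g \<in> carrier \<Gamma>" "f \<in> rkhs_carrier K"
  shows "translation g (translation (inv\<^bsub>\<Gamma>\<^esub> g) f) = f" "translation (inv\<^bsub>\<Gamma>\<^esub> g) (translation g f) = f"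
  using assms by (simp_all flip: translation_mult add: translation_one)

lemma translation_linear:
  assumes g: "g \<in> carrier \<Gamma>" and f: "f \<in> rkhs_carrier K" and h: "h \<in> rkhs_carrier K"
  shows "translation g (f \<oplus>\<^bsub>rkhs K\<^esub> h) = translation g f \<oplus>\<^bsub>rkhs K\<^esub> translation g h"
    and "translation g (c \<odot>\<^bsub>rkhs K\<^esub> f) = c \<odot>\<^bsub>rkhs K\<^esub> translation g f"
    and "translation g (f \<ominus>\<^bsub>rkhs K\<^esub> h) = translation g f \<ominus>\<^bsub>rkhs K\<^esub> translation g h"
  using assms
  by (auto simp: rkhs_add rkhs_minus_carrier translation_apply rkhs_carrier_add rkhs_carrier_scale rkhs_carrier_diff)

lemma translation_in_unitary:
  assumes g: "g \<in> carrier \<Gamma>" shows "translation g \<in> unitary (rkhs K)"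
proof -
  have "bij_betw (translation g) (rkhs_carrier K) (rkhs_carrier K)"
    by (rule bij_betw_byWitness[where f' = "translation (inv\<^bsub>\<Gamma>\<^esub> g)"]) (use g in auto)
  then have "translation g \<in> Bij (carrier (rkhs K))"
    by (simp add: Bij_def translation_def)
  then show ?thesis
    unfolding unitary_def using translation_linear[OF g] inner_translation[OF g] by simp
qed

lemma translation_hom: "translation \<in> hom \<Gamma> (unitary_group (rkhs K))"
proof (rule homI)
  show "translation g \<in> carrier (unitary_group (rkhs K))" if "g \<in> carrier \<Gamma>" for g
    using translation_in_unitary[OF that] by (simp add: unitary_group_def)
  show "translation (g \<otimes>\<^bsub>\<Gamma>\<^esub> h) = translation g \<otimes>\<^bsub>unitary_group (rkhs K)\<^esub> translation h"
    if g: "g \<in> carrier \<Gamma>" and h: "h \<in> carrier \<Gamma>" for g h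
  proof -
    have "translation g \<in> Bij (rkhs_carrier K)" "translation h \<in> Bij (rkhs_carrier K)"
      using translation_in_unitary g h by (auto simp: unitary_def)
    moreover have "translation (g \<otimes>\<^bsub>\<Gamma>\<^esub> h) = compose (rkhs_carrier K) (translation g) (translation h)"
    proof
      show "translation (g \<otimes>\<^bsub>\<Gamma>\<^esub> h) f = compose (rkhs_carrier K) (translation g) (translation h) f" for f
      proof (cases "f \<in> rkhs_carrier K")
        case True
        then show ?thesis using translation_mult[OF g h] by (simp add: compose_eq)
      next
        case False
        then show ?thesis by (simp add: translation_def compose_def)
      qed
    qed
    ultimately show ?thesis by (simp add: unitary_group_def BijGroup_def)
  qed
qed

lemma cdist_translation:
  assumes "g \<in> carrier \<Gamma>" "f \<in> rkhs_carrier K" "h \<in> rkhs_carrier K"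
  shows "cdist (rkhs K) (translation g f) (translation g h) = cdist (rkhs K) f h"
proof -
  have "f \<ominus>\<^bsub>rkhs K\<^esub> h \<in> rkhs_carrier K"
    using assms by (simp add: rkhs_minus_carrier rkhs_carrier_diff)
  then have "rkhs_inner K (translation g (f \<ominus>\<^bsub>rkhs K\<^esub> h)) (translation g (f \<ominus>\<^bsub>rkhs K\<^esub> h)) =
      rkhs_inner K (f \<ominus>\<^bsub>rkhs K\<^esub> h) (f \<ominus>\<^bsub>rkhs K\<^esub> h)"
    using assms(1) by (intro inner_translation)
  then show ?thesis using assms by (simp add: cdist_def cnorm_def flip: translation_linear(3))
qed

text \<open>
  For a combination \<open>xs\<close> of kernel functions close to \<open>\<xi>\<close>, the elements \<open>h\<close> that move each of the
  finitely many indices of \<open>xs\<close> in the same way as \<open>g\<close> form an open set, and for them \<open>h\<close> and \<open>g\<close>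
  agree on \<open>xs\<close>. As translations are isometries, they then almost agree on \<open>\<xi>\<close>.
\<close>

lemma translation_continuous:
  assumes top: "topspace \<T> = carrier \<Gamma>"
    and cont: "\<And>i. continuous_map \<T> (discrete_topology UNIV) (\<lambda>g. act g i)"
    and \<xi>: "\<xi> \<in> rkhs_carrier K"
  shows "continuous_map \<T> (norm_topology (rkhs K)) (\<lambda>g. translation g \<xi>)"
  unfolding norm_topology_eq Met.continuous_map_to_metric
proof (intro ballI allI impI)
  fix g and e :: real assume "g \<in> topspace \<T>" "e > 0"
  then have g: "g \<in> carrier \<Gamma>" and "e / 2 > 0" using top by auto
  obtain X where "represents K X \<xi>" using \<xi> rkhs_carrierE by metis
  from tendstoD[OF cdist_comb_fun_tendsto[OF this] \<open>e / 2 > 0\<close>]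
  obtain xs where xs: "cdist (rkhs K) \<xi> (comb_fun K xs) < e / 2"
    by (auto simp: eventually_sequentially)
  define U where "U = {h \<in> topspace \<T>. \<forall>i\<in>snd ` set xs. act h i = act g i}"
  have "openin \<T> U"
  proof -
    have "openin \<T> {h \<in> topspace \<T>. act h i \<in> {act g i}}" for i
      by (rule openin_continuous_map_preimage[OF cont]) simp
    then have "openin \<T> (topspace \<T> \<inter> \<Inter>((\<lambda>i. {h \<in> topspace \<T>. act h i = act g i}) ` (snd ` set xs)))"
      by (intro openin_Int_Inter) auto
    also have "topspace \<T> \<inter> \<Inter>((\<lambda>i. {h \<in> topspace \<T>. act h i = act g i}) ` (snd ` set xs)) = U"
      by (auto simp: U_def)
    finally show ?thesis .
  qed
  moreover have "g \<in> U" using g by (simp add: U_def top)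
  moreover have "translation h \<xi> \<in> Met.mball (translation g \<xi>) e" if "h \<in> U" for h
  proof -
    have h: "h \<in> carrier \<Gamma>" using that top by (simp add: U_def)
    have "shift h xs = shift g xs" using that by (auto simp: U_def apsnd_def map_prod_def)
    then have eq: "translation h (comb_fun K xs) = translation g (comb_fun K xs)"
      by (simp only: translation_comb_fun g h)
    have "cdist (rkhs K) (translation g \<xi>) (translation h \<xi>) \<le>
        cdist (rkhs K) (translation g \<xi>) (translation g (comb_fun K xs))
        + cdist (rkhs K) (translation h (comb_fun K xs)) (translation h \<xi>)"
      unfolding eq using g h \<xi> by (intro cdist_triangle) simp_all
    also have "\<dots> = cdist (rkhs K) \<xi> (comb_fun K xs) + cdist (rkhs K) (comb_fun K xs) \<xi>"
      using g h \<xi> by (simp only: cdist_translation comb_fun_carrier)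
    also have "\<dots> < e" using xs cdist_commute[of "comb_fun K xs" \<xi>] by linarith
    finally show ?thesis unfolding Met.in_mball using g h \<xi> by simp
  qed
  ultimately show "\<exists>U. openin \<T> U \<and> g \<in> U \<and> (\<forall>h\<in>U. translation h \<xi> \<in> Met.mball (translation g \<xi>) e)"
    by blast
qed

text \<open>
  Let \<open>P i\<close> be the projection of the kernel function \<open>e i\<close> to a closed invariant subspace \<open>W\<close>. The
  Gram kernels \<open>K1\<close> of the \<open>P i\<close> and \<open>K2\<close> of the \<open>e i - P i\<close> are invariant and add up to \<open>K\<close>, so
  extremality gives \<open>K1 = t K\<close>. By the reproducing property \<open>K1 (i, j)\<close> is the value of \<open>P i\<close> at
  \<open>j\<close>, whence \<open>P i = t e i\<close>. For \<open>t = 0\<close> all kernel functions are orthogonal to \<open>W\<close>, which is then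
  zero; otherwise they all lie in \<open>W\<close>, and \<open>W\<close> is everything by density.
\<close>

lemma translation_irreducible:
  assumes ext: "extreme_kernel (act ` carrier \<Gamma>) T K"
    and T: "T = (\<lambda>g. act g p) ` carrier \<Gamma>"
  shows "irreducible_rep \<Gamma> (rkhs K) translation"
  unfolding irreducible_rep_def
proof (intro conjI allI impI)
  define e where "e i = (\<lambda>j. K (i, j))" for i
  have e [simp]: "e i \<in> rkhs_carrier K" for i by (simp add: e_def)
  have e_inner: "rkhs_inner K f (e i) = f i" if "f \<in> rkhs_carrier K" for f i
    unfolding e_def by (rule inner_kernel_fun[OF that])
  have p: "p \<in> T" using T act_one by (metis Gam.one_closed imageI)
  have "K (p, p) = 1" using ext p by (simp add: extreme_kernel_def normalized_kernels_def)
  then have "e p p \<noteq> 0" by (simp add: e_def)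
  then have "e p \<noteq> (\<lambda>_. 0)" by (auto simp only: fun_eq_iff)
  then show "carrier (rkhs K) \<noteq> {\<zero>\<^bsub>rkhs K\<^esub>}"
    unfolding rkhs_simps using e[of p] by blast
  fix W assume "submodule W complex_field (rkhs K) \<and> closedin (norm_topology (rkhs K)) W \<and>
    (\<forall>g\<in>carrier \<Gamma>. \<forall>w\<in>W. translation g w \<in> W)"
  then have W: "submodule W complex_field (rkhs K)" and closed: "closedin (norm_topology (rkhs K)) W"
    and W_inv: "\<And>g w. g \<in> carrier \<Gamma> \<Longrightarrow> w \<in> W \<Longrightarrow> translation g w \<in> W" by auto
  have WH: "w \<in> rkhs_carrier K" if "w \<in> W" for w using submoduleE(1)[OF W] that by auto
  have "\<exists>p\<in>W. \<forall>w\<in>W. rkhs_inner K (e i \<ominus>\<^bsub>rkhs K\<^esub> p) w = 0" for i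
    using orthogonal_projection[OF rkhs_mcomplete W closed, of "e i"] by simp
  then obtain P where PW: "\<And>i. P i \<in> W"
    and orth: "\<And>i w. w \<in> W \<Longrightarrow> rkhs_inner K (e i \<ominus>\<^bsub>rkhs K\<^esub> P i) w = 0"
    by metis
  have P [simp]: "P i \<in> rkhs_carrier K" for i using WH PW by blast
  \<comment> \<open>Both sides project \<open>e (act g i)\<close> to \<open>W\<close>, since translation by \<open>g\<close> preserves
    \<open>W\<close> and its orthogonal complement.\<close>
  have P_translation: "P (act g i) = translation g (P i)" if g: "g \<in> carrier \<Gamma>" for g i
  proof (rule orthogonal_projection_unique[OF W])
    show "e (act g i) \<in> carrier (rkhs K)" "P (act g i) \<in> W" by (simp_all add: PW)
    show "translation g (P i) \<in> W" using W_inv g PW by blast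
    show "cinner (rkhs K) (e (act g i) \<ominus>\<^bsub>rkhs K\<^esub> P (act g i)) w = 0" if "w \<in> W" for w
      using orth[OF that] by simp
    show "cinner (rkhs K) (e (act g i) \<ominus>\<^bsub>rkhs K\<^esub> translation g (P i)) w = 0" if w: "w \<in> W" for w
    proof -
      define v where "v = translation (inv\<^bsub>\<Gamma>\<^esub> g) w"
      have v: "v \<in> W" using W_inv g w by (simp add: v_def)
      have "w = translation g v" using g WH[OF w] by (simp add: v_def)
      moreover have "e (act g i) \<ominus>\<^bsub>rkhs K\<^esub> translation g (P i) = translation g (e i \<ominus>\<^bsub>rkhs K\<^esub> P i)"
        using translation_linear(3)[OF g e P, of i i] translation_kernel_fun[OF g, of i] by (simp add: e_def)
      moreover have "e i \<ominus>\<^bsub>rkhs K\<^esub> P i \<in> rkhs_carrier K"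
        by (simp add: rkhs_minus_carrier rkhs_carrier_diff)
      ultimately show ?thesis using inner_translation[OF g _ WH[OF v]] orth[OF v] by simp
    qed
  qed
  define K1 where "K1 = (\<lambda>(i, j). rkhs_inner K (P i) (P j))"
  define K2 where "K2 = (\<lambda>(i, j). rkhs_inner K (e i \<ominus>\<^bsub>rkhs K\<^esub> P i) (e j \<ominus>\<^bsub>rkhs K\<^esub> P j))"
  \<comment> \<open>Orthogonality allows \<open>P j\<close> to be replaced by \<open>e j\<close>, and the reproducing property applies.\<close>
  have K1_P: "K1 (i, j) = P i j" for i j
  proof -
    have R: "e j \<ominus>\<^bsub>rkhs K\<^esub> P j \<in> rkhs_carrier K" by (simp add: rkhs_minus_carrier rkhs_carrier_diff)
    have "rkhs_inner K (P i) (e j \<ominus>\<^bsub>rkhs K\<^esub> P j) = 0"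
      using inner_commute[OF R P[of i]] orth[OF PW, of j i] by simp
    then show ?thesis
      using cinner_diff_right[of "e j" "P j" "P i"] e_inner[of "P i" j] by (simp add: K1_def)
  qed
  have "psd_kernel K1" unfolding K1_def
    using psd_kernel_cinner[of P] by (simp add: image_subset_iff)
  moreover have "psd_kernel K2" unfolding K2_def
    using psd_kernel_cinner[of "\<lambda>i. e i \<ominus>\<^bsub>rkhs K\<^esub> P i"]
    by (simp add: image_subset_iff rkhs_minus_carrier rkhs_carrier_diff)
  moreover have sum: "K x = K1 x + K2 x" for x
  proof -
    obtain i j where x: "x = (i, j)" by fastforce
    have R: "e i \<ominus>\<^bsub>rkhs K\<^esub> P i \<in> rkhs_carrier K" by (simp add: rkhs_minus_carrier rkhs_carrier_diff)
    have "K2 (i, j) = rkhs_inner K (e i \<ominus>\<^bsub>rkhs K\<^esub> P i) (e j)"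
      using cinner_diff_right[of "e j" "P j" "e i \<ominus>\<^bsub>rkhs K\<^esub> P i"] R orth[OF PW, of i j] by (simp add: K2_def)
    also have "\<dots> = e i j - P i j"
      using e_inner[OF R, of j] by (simp add: rkhs_minus_carrier)
    finally show ?thesis by (simp add: x K1_P e_def)
  qed
  moreover have inv1: "invariant_kernel (act ` carrier \<Gamma>) K1"
    by (auto simp: invariant_kernel_def K1_def P_translation inner_translation)
  moreover have "invariant_kernel (act ` carrier \<Gamma>) K2"
  proof -
    have "K2 x = K x - K1 x" for x using sum[of x] by simp
    then show ?thesis using inv1 invariant by (auto simp: invariant_kernel_def)
  qed
  moreover have "\<exists>a\<in>act ` carrier \<Gamma>. a i = j" if ij: "i \<in> T" "j \<in> T" for i j
  proof -
    obtain g h where g: "g \<in> carrier \<Gamma>" "i = act g p" and h: "h \<in> carrier \<Gamma>" "j = act h p"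
      using ij T by auto
    then have "act (h \<otimes>\<^bsub>\<Gamma>\<^esub> inv\<^bsub>\<Gamma>\<^esub> g) i = j" by (simp add: act_mult)
    then show ?thesis using g h by blast
  qed
  ultimately obtain t :: real where t: "\<And>x. K1 x = of_real t * K x"
    using extreme_kernel_summand[OF ext, of K1 K2 p] p by blast
  have P_eq: "P i = (\<lambda>j. of_real t * e i j)" for i
  proof
    show "P i j = of_real t * e i j" for j using t[of "(i, j)"] by (simp add: K1_P e_def)
  qed
  show "W = {\<zero>\<^bsub>rkhs K\<^esub>} \<or> W = carrier (rkhs K)"
  proof (cases "t = 0")
    case True
    have "w = (\<lambda>_. 0)" if w: "w \<in> W" for w
    proof
      fix i
      have "e i \<ominus>\<^bsub>rkhs K\<^esub> P i = e i" using True by (simp add: rkhs_minus_carrier P_eq[of i])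
      then have "rkhs_inner K (e i) w = 0" using orth[OF w, of i] by simp
      then show "w i = 0" using e_inner[OF WH[OF w], of i] inner_commute[OF e[of i] WH[OF w]] by simp
    qed
    moreover have "\<zero>\<^bsub>rkhs K\<^esub> \<in> W" using subgroup.one_closed[OF submodule.axioms(1)[OF W]] by simp
    ultimately have "W = {\<zero>\<^bsub>rkhs K\<^esub>}" unfolding rkhs_simps by blast
    then show ?thesis ..
  next
    case False
    have "e i \<in> W" for i
    proof -
      have "of_real (1 / t) \<odot>\<^bsub>rkhs K\<^esub> P i \<in> W"
        by (rule submoduleE(4)[OF W _ PW]) (simp add: complex_field_def)
      moreover have "of_real (1 / t) \<odot>\<^bsub>rkhs K\<^esub> P i = e i"
        using False by (simp add: P_eq[of i])
      ultimately show ?thesis by simp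
    qed
    then show ?thesis using closed_submodule_eq_carrier[OF W closed] by (simp add: e_def)
  qed
qed

end

section \<open>Separating the elements of a permutation group\<close>

text \<open>
  The index set is discrete, so that the continuity of the orbit maps expresses pointwise
  convergence. The orbit on which the kernel lives is that of \<open>p\<close>, the point at which \<open>x\<close> and \<open>y\<close>
  differ.
\<close>

theorem exists_separating_irreducible_rep:
  fixes \<Gamma> :: "'g monoid" and act :: "'g \<Rightarrow> 'i::countable \<Rightarrow> 'i"
  assumes group: "group \<Gamma>" and top: "topspace \<T> = carrier \<Gamma>"
    and act_one: "\<And>i. act \<one>\<^bsub>\<Gamma>\<^esub> i = i"
    and act_mult: "\<And>g h i. g \<in> carrier \<Gamma> \<Longrightarrow> h \<in> carrier \<Gamma> \<Longrightarrow> act (g \<otimes>\<^bsub>\<Gamma>\<^esub> h) i = act g (act h i)"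
    and cont: "\<And>i. continuous_map \<T> (discrete_topology UNIV) (\<lambda>g. act g i)"
    and xy: "x \<in> carrier \<Gamma>" "y \<in> carrier \<Gamma>" "act x p \<noteq> act y p"
  shows "\<exists>(H :: ('i \<Rightarrow> complex) cinner_space) \<pi>.
    continuous_unitary_rep \<Gamma> \<T> H \<pi> \<and> irreducible_rep \<Gamma> H \<pi> \<and> \<pi> x \<noteq> \<pi> y"
proof -
  interpret Gam: group \<Gamma> by fact
  define T where "T = (\<lambda>g. act g p) ` carrier \<Gamma>"
  have inj: "inj (act g)" if "g \<in> carrier \<Gamma>" for g
    by (rule inj_on_inverseI[of _ "act (inv\<^bsub>\<Gamma>\<^esub> g)"]) (simp add: that act_one flip: act_mult)
  have stable: "act g i \<in> T \<longleftrightarrow> i \<in> T" if g: "g \<in> carrier \<Gamma>" for g i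
  proof
    assume "i \<in> T" then show "act g i \<in> T" using g by (auto simp: T_def simp flip: act_mult)
  next
    assume "act g i \<in> T"
    then obtain h where h: "h \<in> carrier \<Gamma>" "act g i = act h p" by (auto simp: T_def)
    have "i = act (inv\<^bsub>\<Gamma>\<^esub> g) (act g i)" using g by (simp add: act_one flip: act_mult)
    also have "\<dots> = act (inv\<^bsub>\<Gamma>\<^esub> g \<otimes>\<^bsub>\<Gamma>\<^esub> h) p" using g h by (simp add: act_mult)
    finally show "i \<in> T" using g h by (simp add: T_def)
  qed
  have "inj a" if "a \<in> act ` carrier \<Gamma>" for a
    using that inj by blast
  moreover have "a i \<in> T \<longleftrightarrow> i \<in> T" if "a \<in> act ` carrier \<Gamma>" for a i
    using that stable by blast
  ultimately obtain K
    where ext: "extreme_kernel (act ` carrier \<Gamma>) T K" and sep: "K (act x p, act y p) \<noteq> 1"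
    using exists_extreme_kernel[of "act ` carrier \<Gamma>" T, OF _ _ xy(3)] by blast
  then have K: "psd_kernel K" "invariant_kernel (act ` carrier \<Gamma>) K" "\<And>i. K (i, i) = of_bool (i \<in> T)"
    by (auto simp: extreme_kernel_def normalized_kernels_def)
  interpret invariant_positive_kernel K \<Gamma> act
    using K(1,2) by unfold_locales (simp_all add: act_one act_mult invariant_kernel_def)
  have "translation x \<noteq> translation y"
  proof
    assume "translation x = translation y"
    then have "(\<lambda>j. K (act x p, j)) = (\<lambda>j. K (act y p, j))"
      using translation_kernel_fun[OF xy(1), of p] translation_kernel_fun[OF xy(2), of p] by simp
    then have "K (act x p, act y p) = K (act y p, act y p)" by (rule fun_cong)
    also have "\<dots> = 1" using K(3)[of "act y p"] xy(2) by (simp add: T_def)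
    finally show False using sep by simp
  qed
  moreover have "irreducible_rep \<Gamma> (rkhs K) translation"
    by (rule translation_irreducible[OF ext T_def])
  moreover have "continuous_unitary_rep \<Gamma> \<T> (rkhs K) translation"
    unfolding continuous_unitary_rep_def
    using rkhs_hilbert translation_hom translation_continuous[OF top cont] by simp
  ultimately show ?thesis by blast
qed

theorem theorem1p1:
  fixes X :: "'a set" and G :: "('a \<Rightarrow> 'a) set" and x y :: "'a \<Rightarrow> 'a"
  assumes "countable X" and "infinite X"
    and "subgroup G (BijGroup X)"
    and "x \<in> G" and "y \<in> G" and "x \<noteq> y"
  shows "\<exists>(H :: (nat \<Rightarrow> complex) cinner_space) \<pi>.
    continuous_unitary_rep (BijGroup X\<lparr>carrier := G\<rparr>)
      (subtopology (pointwise_topology X) G) H \<pi> \<and>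
    irreducible_rep (BijGroup X\<lparr>carrier := G\<rparr>) H \<pi> \<and>
    \<pi> x \<noteq> \<pi> y"
proof -
  define c where "c = to_nat_on X"
  define d where "d = from_nat_into X"
  have cd [simp]: "c (d n) = n" for n
    unfolding c_def d_def using assms(1,2) by (rule to_nat_on_from_nat_into_infinite)
  have dc [simp]: "d (c z) = z" if "z \<in> X" for z
    unfolding c_def d_def using assms(1) that by (rule from_nat_into_to_nat_on)
  have dX [simp]: "d n \<in> X" for n
    unfolding d_def using assms(2) by (intro from_nat_into) auto
  have GX: "G \<subseteq> Bij X" using subgroup.subset[OF assms(3)] by (simp add: BijGroup_def)
  have maps: "g z \<in> X" if "g \<in> G" "z \<in> X" for g z
    using GX that Bij_imp_funcset by blast
  \<comment> \<open>The permutations of \<open>X\<close> are conjugated to permutations of the natural numbers,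
    on which the functions of the Hilbert space are defined.\<close>
  define act where "act g n = c (g (d n))" for g :: "'a \<Rightarrow> 'a" and n
  let ?\<Gamma> = "BijGroup X\<lparr>carrier := G\<rparr>" and ?T = "subtopology (pointwise_topology X) G"
  have "\<exists>z\<in>X. x z \<noteq> y z"
  proof (rule ccontr)
    assume "\<not> (\<exists>z\<in>X. x z \<noteq> y z)"
    then have "x = y"
      using assms(4,5) GX Bij_imp_extensional by (intro extensionalityI[of x X y]) auto
    then show False using assms(6) by simp
  qed
  then obtain z where z: "z \<in> X" "x z \<noteq> y z" by blast
  show ?thesis
  proof (rule exists_separating_irreducible_rep[of ?\<Gamma> ?T act x y "c z"])
    show "group ?\<Gamma>" using subgroup.subgroup_is_group[OF assms(3) group_BijGroup] .
    show "topspace ?T = carrier ?\<Gamma>"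
    proof -
      have "G \<subseteq> PiE X (\<lambda>_. X)"
        using GX Bij_imp_extensional maps by (auto simp: PiE_def)
      then show ?thesis using GX by (auto simp: pointwise_topology_def BijGroup_def)
    qed
    show "act \<one>\<^bsub>?\<Gamma>\<^esub> i = i" for i by (simp add: act_def BijGroup_def)
    show "act (g \<otimes>\<^bsub>?\<Gamma>\<^esub> h) i = act g (act h i)" if "g \<in> carrier ?\<Gamma>" "h \<in> carrier ?\<Gamma>" for g h i
      using that GX by (auto simp: act_def BijGroup_def compose_def maps subset_iff)
    show "continuous_map ?T (discrete_topology UNIV) (\<lambda>g. act g i)" for i
    proof -
      have "continuous_map (product_topology (\<lambda>_. discrete_topology X) X) (discrete_topology X) (\<lambda>g. g (d i))"
        by (rule continuous_map_product_projection) simp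
      then have "continuous_map ?T (discrete_topology X) (\<lambda>g. g (d i))"
        unfolding pointwise_topology_def by (intro continuous_map_from_subtopology)
      moreover have "continuous_map (discrete_topology X) (discrete_topology UNIV) c" by simp
      ultimately have "continuous_map ?T (discrete_topology UNIV) (c \<circ> (\<lambda>g. g (d i)))"
        by (rule continuous_map_compose)
      then show ?thesis by (simp add: act_def comp_def)
    qed
    show "x \<in> carrier ?\<Gamma>" "y \<in> carrier ?\<Gamma>" using assms(4,5) by simp_all
    show "act x (c z) \<noteq> act y (c z)"
    proof
      assume "act x (c z) = act y (c z)"
      then have "d (c (x z)) = d (c (y z))" using z by (simp add: act_def)
      then show False using z maps assms(4,5) by simp
    qed
  qed
qed

end
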